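(* Let $K$ be a simplicial complex whose vertices are partitioned into $m+1$ subsets $V_0,\ldots,V_m$, and let $A$ be a nontrivial abelian group. Let $M$ be a $d$-dimensional pseudomanifold with vertex set $\{0,\dots,m\}$ such that $\widetilde{H}_d(M,A)\cong A$. Suppose that $\widetilde{H}_{|\sigma|-2}\big(K[\bigcup_{i\in\sigma}V_i],A\big)=0$ for every simplex $\sigma\in M$. If moreover $\widetilde{H}_d(K,A)=0$, then the number of $(d+1)$-dimensional colourful simplices in $K$ is at least $m-d$.
   Context: Simplicial complexes are abstract and the empty set is not a simplex, so the minimal dimension of a simplex is $0$. $\widetilde{H}$ denotes reduced simplicial homology; $\widetilde{H}_{-1}(Y,A)=0$ if and only if $Y$ is nonempty. A pseudomanifold is a simplicial complex that is pure, non-branching (each ridge, i.e. codimension-one face of a facet, is contained in exactly two facets), and strongly connected (the dual graph, whose vertices are the facets and whose edges join facets sharing a ridge, is connected). For a subset $U$ of the vertices of $K$, $K[U]$ is the subcomplex induced by $U$: its simplices are exactly the simplices of $K$ all of whose vertices are in $U$. A colourful simplex of $K$ is a simplex with at most one vertex in each $V_i$. $|\sigma|$ is the number of vertices of $\sigma$. *)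

theory Defs
  imports
    "HOL-Algebra.Elementary_Groups"
    "HOL-Algebra.FiniteProduct"
    "HOL-Combinatorics.Permutations"
    "HOL-Library.Disjoint_Sets"
begin

definition simplicial_complex :: "'v set set \<Rightarrow> bool" where
  "simplicial_complex K \<longleftrightarrow>
     (\<forall>\<sigma>\<in>K. finite \<sigma> \<and> \<sigma> \<noteq> {}) \<and> (\<forall>\<sigma>\<in>K. \<forall>\<tau>. \<tau> \<subseteq> \<sigma> \<and> \<tau> \<noteq> {} \<longrightarrow> \<tau> \<in> K)"

definition vertices :: "'v set set \<Rightarrow> 'v set" where
  "vertices K = \<Union>K"

definition induced_subcomplex :: "'v set set \<Rightarrow> 'v set \<Rightarrow> 'v set set" where
  "induced_subcomplex K U = {\<sigma> \<in> K. \<sigma> \<subseteq> U}"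

definition has_dim :: "'v set \<Rightarrow> nat \<Rightarrow> bool" where
  "has_dim \<sigma> n \<longleftrightarrow> finite \<sigma> \<and> card \<sigma> = n + 1"

definition facet :: "'v set set \<Rightarrow> 'v set \<Rightarrow> bool" where
  "facet K \<sigma> \<longleftrightarrow> \<sigma> \<in> K \<and> (\<forall>\<tau>\<in>K. \<sigma> \<subseteq> \<tau> \<longrightarrow> \<tau> = \<sigma>)"

(* A 0-dimensional facet has the empty face as its codimension-one face, so that the
   0-dimensional pseudomanifolds are exactly the complexes consisting of two points. *)
definition ridge :: "'v set set \<Rightarrow> 'v set \<Rightarrow> bool" where
  "ridge K \<rho> \<longleftrightarrow> (\<exists>\<sigma>. facet K \<sigma> \<and> \<rho> \<subseteq> \<sigma> \<and> card \<sigma> = card \<rho> + 1)"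

definition pure_of_dim :: "nat \<Rightarrow> 'v set set \<Rightarrow> bool" where
  "pure_of_dim d K \<longleftrightarrow> (\<forall>\<sigma>. facet K \<sigma> \<longrightarrow> has_dim \<sigma> d)"

definition non_branching :: "'v set set \<Rightarrow> bool" where
  "non_branching K \<longleftrightarrow> (\<forall>\<rho>. ridge K \<rho> \<longrightarrow> card {\<sigma>. facet K \<sigma> \<and> \<rho> \<subseteq> \<sigma>} = 2)"

definition dual_adjacent :: "'v set set \<Rightarrow> 'v set \<Rightarrow> 'v set \<Rightarrow> bool" where
  "dual_adjacent K \<sigma> \<tau> \<longleftrightarrow>
     facet K \<sigma> \<and> facet K \<tau> \<and> \<sigma> \<noteq> \<tau> \<and> (\<exists>\<rho>. ridge K \<rho> \<and> \<rho> \<subseteq> \<sigma> \<and> \<rho> \<subseteq> \<tau>)"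

definition strongly_connected :: "'v set set \<Rightarrow> bool" where
  "strongly_connected K \<longleftrightarrow>
     (\<exists>\<sigma>. facet K \<sigma>) \<and> (\<forall>\<sigma> \<tau>. facet K \<sigma> \<longrightarrow> facet K \<tau> \<longrightarrow> (dual_adjacent K)\<^sup>*\<^sup>* \<sigma> \<tau>)"

definition pseudomanifold :: "nat \<Rightarrow> 'v set set \<Rightarrow> bool" where
  "pseudomanifold d K \<longleftrightarrow>
     simplicial_complex K \<and> pure_of_dim d K \<and> non_branching K \<and> strongly_connected K"

definition colourful :: "nat \<Rightarrow> (nat \<Rightarrow> 'v set) \<Rightarrow> 'v set \<Rightarrow> bool" where
  "colourful m V \<sigma> \<longleftrightarrow> (\<forall>i\<le>m. card (\<sigma> \<inter> V i) \<le> 1)"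

definition colourful_simplices ::
    "'v set set \<Rightarrow> nat \<Rightarrow> (nat \<Rightarrow> 'v set) \<Rightarrow> nat \<Rightarrow> 'v set set" where
  "colourful_simplices K m V n = {\<sigma> \<in> K. has_dim \<sigma> n \<and> colourful m V \<sigma>}"

(* Simplicial chains with coefficients in an abelian group A (written multiplicatively as
   everywhere in HOL-Algebra) are the finitely supported functions on ordered simplices
   [v0,...,vn] that are multiplied by the sign of a permutation when the vertices are permuted,
   i.e. the usual oriented chains. The chain complex is augmented: the empty list is the unique
   generator in degree -1, which is what makes the homology reduced. *)
definition ordered_simplices :: "'v set set \<Rightarrow> int \<Rightarrow> 'v list set" where
  "ordered_simplices K n =
     {xs. distinct xs \<and> int (length xs) = n + 1 \<and> (xs = [] \<or> set xs \<in> K)}"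

definition chain_group ::
    "'v set set \<Rightarrow> ('a, 'b) monoid_scheme \<Rightarrow> int \<Rightarrow> ('v list \<Rightarrow> 'a) monoid" where
  "chain_group K A n =
     \<lparr>carrier = {c. (\<forall>xs. c xs \<in> carrier A) \<and>
                    (\<forall>xs. c xs \<noteq> \<one>\<^bsub>A\<^esub> \<longrightarrow> xs \<in> ordered_simplices K n) \<and>
                    finite {xs. c xs \<noteq> \<one>\<^bsub>A\<^esub>} \<and>
                    (\<forall>xs p. p permutes {..<length xs} \<longrightarrow>
                       c (permute_list p xs) = c xs [^]\<^bsub>A\<^esub> sign p)},
      monoid.mult = (\<lambda>c c' xs. c xs \<otimes>\<^bsub>A\<^esub> c' xs),
      monoid.one = (\<lambda>_. \<one>\<^bsub>A\<^esub>)\<rparr>"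

(* The linear extension of [v0,...,vn] |-> sum of (-1)^i [v0,...,vi omitted,...,vn]: the
   oriented simplices having [w1,...,wn] as a face with sign +1 are the [v,w1,...,wn].
   In degree 0 this is the augmentation, and in degree -1 it is trivial. *)
definition boundary :: "('a, 'b) monoid_scheme \<Rightarrow> ('v list \<Rightarrow> 'a) \<Rightarrow> 'v list \<Rightarrow> 'a" where
  "boundary A c ws = (\<Otimes>\<^bsub>A\<^esub>v\<in>{v. c (v # ws) \<noteq> \<one>\<^bsub>A\<^esub>}. c (v # ws))"

definition cycles :: "'v set set \<Rightarrow> ('a, 'b) monoid_scheme \<Rightarrow> int \<Rightarrow> ('v list \<Rightarrow> 'a) set" where
  "cycles K A n = kernel (chain_group K A n) (chain_group K A (n - 1)) (boundary A)"

definition boundaries :: "'v set set \<Rightarrow> ('a, 'b) monoid_scheme \<Rightarrow> int \<Rightarrow> ('v list \<Rightarrow> 'a) set" where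
  "boundaries K A n = boundary A ` carrier (chain_group K A (n + 1))"

definition reduced_homology ::
    "'v set set \<Rightarrow> ('a, 'b) monoid_scheme \<Rightarrow> int \<Rightarrow> ('v list \<Rightarrow> 'a) set monoid" where
  "reduced_homology K A n =
     (chain_group K A n)\<lparr>carrier := cycles K A n\<rparr> Mod boundaries K A n"

end

theory Submission
  imports Defs
begin

text \<open>
  Strong connectivity and non-branching force every nonzero \<open>d\<close>-cycle \<open>z\<close> of \<open>M\<close> to take values
  \<open>a\<close> and \<open>-a\<close> on the facets, for a single \<open>a \<noteq> 0\<close>. Acyclic carriers give chains \<open>\<phi> \<sigma>\<close> of
  \<open>K[V_\<sigma>]\<close> with \<open>\<partial>(\<phi> \<sigma>) = \<phi>(\<partial>\<sigma>)\<close>, starting from the coefficient \<open>a\<close> on the empty simplex.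
  Only this one coefficient is lifted, since a lift need not be additive in it; hence \<open>2a = 0\<close>
  would not give \<open>2(\<phi> \<sigma>) = 0\<close>. Here the isomorphism of the homology of \<open>M\<close> with \<open>A\<close> enters:
  \<open>z\<close> can be chosen such that \<open>2a = 0\<close> only if \<open>A\<close> has exponent 2. So \<open>z\<close> yields a \<open>d\<close>-cycle of
  \<open>K\<close>, which bounds a chain \<open>c\<close>. Sending each vertex to its colour maps \<open>\<phi> \<sigma>\<close> to \<open>a\<sigma>\<close> and kills
  all simplices that are not colourful, so the image of \<open>c\<close> in the full simplex on \<open>m + 1\<close>
  vertices bounds \<open>z\<close> and its support is no larger than the number of colourful simplices. A chain
  bounded by \<open>z\<close> has at least \<open>m - d\<close> simplices: some strongly connected part of its support covers
  all vertices, and growing it from one simplex adds at most one vertex at a time.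
\<close>

section \<open>Finitely supported products in an abelian group\<close>

context comm_group
begin

lemma finprod_swap:
  assumes "finite I" "finite J" "\<And>i j. i \<in> I \<Longrightarrow> j \<in> J \<Longrightarrow> g i j \<in> carrier G"
  shows "(\<Otimes>i\<in>I. \<Otimes>j\<in>J. g i j) = (\<Otimes>j\<in>J. \<Otimes>i\<in>I. g i j)"
  using assms(1,3)
proof (induction I)
  case empty
  then show ?case by (simp add: finprod_one_eqI)
next
  case (insert x I)
  have "(\<Otimes>j\<in>J. \<Otimes>i\<in>insert x I. g i j) = (\<Otimes>j\<in>J. g x j \<otimes> (\<Otimes>i\<in>I. g i j))"
    by (rule finprod_cong') (use insert in \<open>auto intro!: finprod_closed\<close>)
  also have "\<dots> = (\<Otimes>j\<in>J. g x j) \<otimes> (\<Otimes>j\<in>J. \<Otimes>i\<in>I. g i j)"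
    by (rule finprod_multf) (use insert in \<open>auto intro!: finprod_closed\<close>)
  finally show ?case
    using insert by (subst finprod_insert) (auto intro!: finprod_closed)
qed

lemma finprod_int_pow:
  assumes "\<And>i. i \<in> I \<Longrightarrow> f i \<in> carrier G"
  shows "(\<Otimes>i\<in>I. f i) [^] (n::int) = (\<Otimes>i\<in>I. f i [^] n)"
  using assms
proof (induction I rule: infinite_finite_induct)
  case (insert x I)
  then have "f x \<in> carrier G" "f \<in> I \<rightarrow> carrier G" "(\<lambda>i. f i [^] n) \<in> I \<rightarrow> carrier G"
    by auto
  then show ?case using insert by (simp add: int_pow_distrib)
qed auto

lemma finprod_delta:
  assumes "finite I" "x \<in> I" "f x \<in> carrier G" "\<And>i. i \<in> I \<Longrightarrow> i \<noteq> x \<Longrightarrow> f i = \<one>"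
  shows "finprod G f I = f x"
proof -
  have "finprod G f {x} = finprod G f I"
    by (rule finprod_mono_neutral_cong_left) (use assms in fastforce)+
  then show ?thesis using assms(3) by simp
qed

text \<open>The entries at \<open>(i, j)\<close> and \<open>(j, i)\<close> cancel. The diagonal is
  trivial by hypothesis, since antisymmetry alone only makes its entries of order at most 2. Later
  proofs that a boundary of a boundary is trivial end here.\<close>

lemma finprod_antisymmetric:
  assumes "finite I"
    and "\<And>i j. i \<in> I \<Longrightarrow> j \<in> I \<Longrightarrow> g i j \<in> carrier G"
    and "\<And>i. i \<in> I \<Longrightarrow> g i i = \<one>"
    and "\<And>i j. i \<in> I \<Longrightarrow> j \<in> I \<Longrightarrow> g j i = inv (g i j)"
  shows "(\<Otimes>i\<in>I. \<Otimes>j\<in>I. g i j) = \<one>"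
  using assms
proof (induction I)
  case empty
  show ?case by (rule finprod_empty)
next
  case (insert x I)
  have c: "\<And>i. i \<in> insert x I \<Longrightarrow> (\<Otimes>j\<in>I. g i j) \<in> carrier G"
    "\<And>i. i \<in> insert x I \<Longrightarrow> (\<Otimes>j\<in>I. g j i) \<in> carrier G"
    using insert.prems(1) by (auto intro!: finprod_closed)
  have "(\<Otimes>i\<in>insert x I. \<Otimes>j\<in>insert x I. g i j)
      = (\<Otimes>i\<in>insert x I. g i x \<otimes> (\<Otimes>j\<in>I. g i j))"
    by (rule finprod_cong') (use insert.hyps insert.prems(1) c in \<open>auto intro!: finprod_closed\<close>)
  also have "\<dots> = (\<Otimes>i\<in>insert x I. g i x) \<otimes> (\<Otimes>i\<in>insert x I. \<Otimes>j\<in>I. g i j)"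
    by (rule finprod_multf) (use insert.hyps insert.prems(1) c in auto)
  also have "(\<Otimes>i\<in>insert x I. g i x) = (\<Otimes>i\<in>I. g i x)"
    using insert.hyps insert.prems(1,2) c(2)[of x] by (subst finprod_insert) auto
  also have "(\<Otimes>i\<in>insert x I. \<Otimes>j\<in>I. g i j) = (\<Otimes>j\<in>I. g x j)"
    using insert.hyps insert.prems(1) insert.IH[OF insert.prems] c
    by (subst finprod_insert) auto
  also have "(\<Otimes>i\<in>I. g i x) \<otimes> (\<Otimes>i\<in>I. g x i) = (\<Otimes>i\<in>I. g i x \<otimes> g x i)"
    by (rule finprod_multf[symmetric]) (use insert.prems(1) in auto)
  also have "\<dots> = \<one>"
  proof (rule finprod_one_eqI)
    fix i assume "i \<in> I"
    then have "g x i = inv (g i x)" "g i x \<in> carrier G"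
      using insert.prems(1,3) by blast+
    then show "g i x \<otimes> g x i = \<one>" by simp
  qed
  finally show ?case .
qed

text \<open>The square array with \<open>h x\<close> at \<open>(x, s x)\<close> and
  \<open>\<one>\<close> elsewhere has row products \<open>h x\<close> and is antisymmetric; its
  diagonal is trivial because \<open>s\<close> has no fixed points.\<close>

lemma finprod_involution:
  assumes "finite D" "h \<in> D \<rightarrow> carrier G"
    and "\<And>x. x \<in> D \<Longrightarrow> s x \<in> D" "\<And>x. x \<in> D \<Longrightarrow> s (s x) = x"
    and "\<And>x. x \<in> D \<Longrightarrow> s x \<noteq> x" "\<And>x. x \<in> D \<Longrightarrow> h (s x) = inv (h x)"
  shows "finprod G h D = \<one>"
proof -
  define g where "g x y = (if y = s x then h x else \<one>)" for x y
  have "finprod G h D = (\<Otimes>x\<in>D. \<Otimes>y\<in>D. g x y)"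
  proof (rule finprod_cong'[OF refl])
    fix x assume x: "x \<in> D"
    have "(\<Otimes>y\<in>D. g x y) = g x (s x)"
      by (rule finprod_delta) (use assms x in \<open>auto simp: g_def\<close>)
    then show "h x = (\<Otimes>y\<in>D. g x y)" by (simp add: g_def)
  qed (use assms in \<open>auto simp: g_def intro!: finprod_closed\<close>)
  also have "\<dots> = \<one>"
  proof (rule finprod_antisymmetric)
    fix x y assume xy: "x \<in> D" "y \<in> D"
    show "g x y \<in> carrier G" using assms(2) xy by (auto simp: g_def)
    show "g x x = \<one>" using assms(5)[OF xy(1)] by (auto simp: g_def)
    show "g y x = inv (g x y)"
    proof (cases "y = s x")
      case True
      then show ?thesis using assms(4,6)[OF xy(1)] by (simp add: g_def)
    next
      case False
      then have "x \<noteq> s y" using assms(4)[OF xy(2)] by auto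
      then show ?thesis using False by (simp add: g_def)
    qed
  qed (use assms in auto)
  finally show ?thesis .
qed

text \<open>\<open>finprod\<close> over an infinite index set is \<open>\<one>\<close>, so only the
  nontrivial factors are multiplied. This allows products over all lists with a given tail or image,
  of which there may be infinitely many.\<close>

definition fprod :: "('c \<Rightarrow> 'a) \<Rightarrow> 'c set \<Rightarrow> 'a" where
  "fprod c D = (\<Otimes>x\<in>{x \<in> D. c x \<noteq> \<one>}. c x)"

definition supp :: "('c \<Rightarrow> 'a) \<Rightarrow> 'c set" where
  "supp c = {x. c x \<noteq> \<one>}"

definition fsupp :: "('c \<Rightarrow> 'a) \<Rightarrow> bool" where
  "fsupp c \<longleftrightarrow> (\<forall>x. c x \<in> carrier G) \<and> finite (supp c)"

lemma fprod_closed: "fsupp c \<Longrightarrow> fprod c D \<in> carrier G"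
  by (auto simp: fprod_def fsupp_def intro!: finprod_closed)

lemma fprod_eq_finprod:
  assumes "fsupp c" "finite F" "F \<subseteq> D" "D \<inter> supp c \<subseteq> F"
  shows "fprod c D = finprod G c F"
  unfolding fprod_def
  by (rule finprod_mono_neutral_cong_left) (use assms in \<open>auto simp: fsupp_def supp_def\<close>)

lemma fprod_neq_oneD: "fprod c D \<noteq> \<one> \<Longrightarrow> \<exists>x\<in>D. c x \<noteq> \<one>"
  unfolding fprod_def using finprod_one_eqI[of "{x \<in> D. c x \<noteq> \<one>}" c] by blast

text \<open>Double products get reordered by splitting one \<open>fprod\<close> along two different
  maps \<open>h\<close>. \<open>Y\<close> may exceed the image, as fibres outside the support
  contribute \<open>\<one>\<close>.\<close>

lemma fprod_partition:
  assumes "fsupp c" "finite Y" "h ` (D \<inter> supp c) \<subseteq> Y"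
  shows "fprod c D = (\<Otimes>y\<in>Y. fprod c {x \<in> D. h x = y})"
proof -
  let ?F = "\<lambda>y. {x \<in> D \<inter> supp c. h x = y}"
  have fin: "finite (D \<inter> supp c)" using assms(1) by (simp add: fsupp_def)
  have "fprod c D = finprod G c (\<Union>(?F ` Y))"
    by (rule fprod_eq_finprod) (use assms in \<open>auto simp: fsupp_def\<close>)
  also have "\<dots> = (\<Otimes>y\<in>Y. finprod G c (?F y))"
    by (rule finprod_UN_disjoint) (use assms fin in \<open>auto simp: fsupp_def pairwise_def disjnt_def\<close>)
  also have "\<dots> = (\<Otimes>y\<in>Y. fprod c {x \<in> D. h x = y})"
  proof (rule finprod_cong'[OF refl])
    fix y assume "y \<in> Y"
    show "finprod G c (?F y) = fprod c {x \<in> D. h x = y}"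
      by (rule fprod_eq_finprod[symmetric]) (use assms fin in \<open>auto simp: fsupp_def\<close>)
  qed (use assms in \<open>auto intro: fprod_closed\<close>)
  finally show ?thesis .
qed

text \<open>An integral linear combination of functions, in multiplicative notation.\<close>

definition comb :: "('i \<Rightarrow> 'c \<Rightarrow> 'a) \<Rightarrow> ('i \<Rightarrow> int) \<Rightarrow> 'i set \<Rightarrow> 'c \<Rightarrow> 'a" where
  "comb f e I = (\<lambda>x. \<Otimes>i\<in>I. f i x [^] e i)"

lemma comb_neq_oneD: "comb f e I x \<noteq> \<one> \<Longrightarrow> \<exists>i\<in>I. f i x \<noteq> \<one>"
  by (rule ccontr) (auto simp: comb_def finprod_one_eqI)

lemma comb_closed: "(\<And>i. i \<in> I \<Longrightarrow> f i x \<in> carrier G) \<Longrightarrow> comb f e I x \<in> carrier G"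
  unfolding comb_def by (auto intro!: finprod_closed)

lemma supp_comb: "supp (comb f e I) \<subseteq> (\<Union>i\<in>I. supp (f i))"
  using comb_neq_oneD by (fastforce simp: supp_def)

lemma fsupp_comb:
  assumes "finite I" "\<And>i. i \<in> I \<Longrightarrow> fsupp (f i)"
  shows "fsupp (comb f e I)"
proof -
  have "finite (\<Union>i\<in>I. supp (f i))" using assms by (simp add: fsupp_def)
  then show ?thesis
    using assms(2) supp_comb[of f e I] by (auto simp: fsupp_def intro: finite_subset comb_closed)
qed

lemma fprod_comb:
  assumes "finite I" "\<And>i. i \<in> I \<Longrightarrow> fsupp (f i)"
  shows "fprod (comb f e I) D = (\<Otimes>i\<in>I. fprod (f i) D [^] e i)"
proof -
  let ?F = "D \<inter> (\<Union>i\<in>I. supp (f i))"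
  have fin: "finite ?F" using assms by (auto simp: fsupp_def)
  have "fprod (comb f e I) D = finprod G (comb f e I) ?F"
    by (rule fprod_eq_finprod) (use fsupp_comb[OF assms] fin supp_comb[of f e I] in auto)
  also have "\<dots> = (\<Otimes>i\<in>I. \<Otimes>x\<in>?F. f i x [^] e i)"
    unfolding comb_def
    by (rule finprod_swap) (use assms fin in \<open>auto simp: fsupp_def\<close>)
  also have "\<dots> = (\<Otimes>i\<in>I. fprod (f i) D [^] e i)"
  proof (rule finprod_cong'[OF refl])
    fix i assume i: "i \<in> I"
    have "(\<Otimes>x\<in>?F. f i x [^] e i) = (\<Otimes>x\<in>?F. f i x) [^] e i"
      by (rule finprod_int_pow[symmetric]) (use assms i in \<open>auto simp: fsupp_def\<close>)
    also have "(\<Otimes>x\<in>?F. f i x) = fprod (f i) D"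
      by (rule fprod_eq_finprod[symmetric]) (use assms i fin in auto)
    finally show "(\<Otimes>x\<in>?F. f i x [^] e i) = fprod (f i) D [^] e i" .
  qed (use assms in \<open>auto intro!: fprod_closed\<close>)
  finally show ?thesis .
qed

section \<open>Oriented chains\<close>

definition alternating :: "('v list \<Rightarrow> 'a) \<Rightarrow> bool" where
  "alternating c \<longleftrightarrow> (\<forall>xs. c xs \<in> carrier G) \<and>
     (\<forall>xs p. p permutes {..<length xs} \<longrightarrow> c (permute_list p xs) = c xs [^] sign p)"

lemma chain_iff:
  "c \<in> carrier (chain_group K G n) \<longleftrightarrow>
     alternating c \<and> finite (supp c) \<and> supp c \<subseteq> ordered_simplices K n"
  by (auto simp: chain_group_def alternating_def supp_def)

lemma chain_fsupp: "c \<in> carrier (chain_group K G n) \<Longrightarrow> fsupp c"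
  by (simp add: chain_iff fsupp_def alternating_def)

lemma chain_suppD:
  assumes "c \<in> carrier (chain_group K G n)" "c xs \<noteq> \<one>"
  shows "distinct xs" "int (length xs) = n + 1" "xs = [] \<or> set xs \<in> K"
  using assms by (auto simp: chain_iff supp_def ordered_simplices_def)

lemma alternating_swap_nth:
  assumes "alternating c" "i < length xs" "j < length xs" "i \<noteq> j"
  shows "c (permute_list (transpose i j) xs) = inv (c xs)"
proof -
  have "transpose i j permutes {..<length xs}"
    using assms by (intro permutes_swap_id) auto
  then have "c (permute_list (transpose i j) xs) = c xs [^] (- 1 :: int)"
    using assms by (simp add: alternating_def sign_swap_id)
  then show ?thesis
    using assms(1) by (simp add: alternating_def int_pow_neg)
qed

lemma alternating_swap:
  assumes "alternating c"
  shows "c (us @ x # y # vs) = inv (c (us @ y # x # vs))"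
proof -
  let ?i = "length us" and ?xs = "us @ y # x # vs"
  have p: "transpose ?i (Suc ?i) permutes {..<length ?xs}"
    by (intro permutes_swap_id) auto
  have "permute_list (transpose ?i (Suc ?i)) ?xs = us @ x # y # vs"
  proof (rule nth_equalityI)
    fix k assume "k < length (permute_list (transpose ?i (Suc ?i)) ?xs)"
    then have k: "k < length ?xs" by simp
    consider "k < ?i" | "k = ?i" | "k = Suc ?i" | "k > Suc ?i" by linarith
    then show "permute_list (transpose ?i (Suc ?i)) ?xs ! k = (us @ x # y # vs) ! k"
    proof cases
      case 4
      then obtain r where "k = Suc (Suc (?i + r))"
        using less_iff_Suc_add by auto
      then show ?thesis
        unfolding permute_list_nth[OF p k]
        by (simp add: transpose_def nth_append)
    qed (use permute_list_nth[OF p k] in \<open>simp_all add: transpose_def nth_append\<close>)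
  qed simp
  then show ?thesis
    using alternating_swap_nth[OF assms, of ?i ?xs "Suc ?i"] by simp
qed

text \<open>Moving \<open>v\<close> behind \<open>us\<close> takes \<open>length us\<close> swaps of
  neighbours, each inverting the coefficient.\<close>

lemma alternating_move:
  assumes "alternating c"
  shows "c (v # us @ vs) = c (us @ v # vs) [^] ((- 1) ^ length us :: int)"
proof (induction us arbitrary: vs rule: rev_induct)
  case Nil
  then show ?case using assms by (simp add: alternating_def)
next
  case (snoc u us)
  have cl: "c xs \<in> carrier G" for xs using assms by (simp add: alternating_def)
  have "c (v # us @ u # vs) = inv (c (us @ u # v # vs)) [^] ((- 1) ^ length us :: int)"
    by (simp add: snoc.IH[of "u # vs"] alternating_swap[OF assms, of us v u vs])
  also have "\<dots> = c (us @ u # v # vs) [^] (- ((- 1) ^ length us) :: int)"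
    using cl by (simp add: int_pow_inv int_pow_neg)
  finally show ?case by simp
qed

lemma alternating_mset_cases:
  assumes "alternating c" "mset xs = mset ys"
  shows "c ys = c xs \<or> c ys = inv (c xs)"
proof -
  have cl: "c xs \<in> carrier G" using assms(1) by (simp add: alternating_def)
  obtain p where "p permutes {..<length xs}" "permute_list p xs = ys"
    using mset_eq_permutation[OF assms(2)[symmetric]] .
  then have p: "c ys = c xs [^] sign p"
    using assms(1) by (auto simp: alternating_def)
  show ?thesis
    by (cases p rule: sign_cases) (use p cl in \<open>auto simp: int_pow_neg\<close>)
qed

lemma alternating_comb:
  fixes f :: "'i \<Rightarrow> 'v list \<Rightarrow> 'a"
  assumes "finite I" "\<And>i. i \<in> I \<Longrightarrow> alternating (f i)"
  shows "alternating (comb f e I)"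
  unfolding alternating_def
proof (intro conjI allI impI)
  fix xs show "comb f e I xs \<in> carrier G"
    using assms(2) by (auto intro!: comb_closed simp: alternating_def)
next
  fix xs p assume p: "p permutes {..<length (xs :: 'v list)}"
  have "comb f e I (permute_list p xs) = (\<Otimes>i\<in>I. (f i xs [^] e i) [^] sign p)"
    unfolding comb_def
  proof (rule finprod_cong'[OF refl])
    fix i assume i: "i \<in> I"
    then have "f i (permute_list p xs) = f i xs [^] sign p" "f i xs \<in> carrier G"
      using assms(2) p by (auto simp: alternating_def)
    then show "f i (permute_list p xs) [^] e i = (f i xs [^] e i) [^] sign p"
      by (simp add: int_pow_pow mult.commute)
  qed (use assms(2) in \<open>auto simp: alternating_def\<close>)
  also have "\<dots> = comb f e I xs [^] sign p"
    unfolding comb_def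
    by (rule finprod_int_pow[symmetric]) (use assms(2) in \<open>auto simp: alternating_def\<close>)
  finally show "comb f e I (permute_list p xs) = comb f e I xs [^] sign p" .
qed

lemma chain_comb:
  assumes "finite I" "\<And>i. i \<in> I \<Longrightarrow> f i \<in> carrier (chain_group K G n)"
  shows "comb f e I \<in> carrier (chain_group K G n)"
  using assms fsupp_comb[of I f e] chain_fsupp supp_comb[of f e I] alternating_comb[of I f e]
  by (fastforce simp: chain_iff fsupp_def)

section \<open>Linearity of the boundary, and homology classes as chains\<close>

lemma boundary_eq_fprod:
  assumes "fsupp c"
  shows "boundary G c ws = fprod c (range (\<lambda>v. v # ws))"
proof -
  have "fprod c (range (\<lambda>v. v # ws)) = finprod G c ((\<lambda>v. v # ws) ` {v. c (v # ws) \<noteq> \<one>})"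
    unfolding fprod_def by (rule arg_cong[where f = "finprod G c"]) auto
  also have "\<dots> = boundary G c ws"
    unfolding boundary_def
    by (rule finprod_reindex) (use assms in \<open>auto simp: fsupp_def inj_on_def\<close>)
  finally show ?thesis by simp
qed

lemma boundary_fsupp:
  assumes "fsupp c"
  shows "fsupp (boundary G c)"
proof -
  have "supp (boundary G c) \<subseteq> tl ` supp c"
  proof
    fix ws assume "ws \<in> supp (boundary G c)"
    then have "fprod c (range (\<lambda>v. v # ws)) \<noteq> \<one>"
      by (simp add: supp_def boundary_eq_fprod[OF assms])
    from fprod_neq_oneD[OF this] obtain v where "c (v # ws) \<noteq> \<one>" by auto
    then show "ws \<in> tl ` supp c" by (force simp: supp_def)
  qed
  moreover have "finite (tl ` supp c)" using assms by (simp add: fsupp_def)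
  ultimately show ?thesis
    using fprod_closed[OF assms] finite_subset
    by (auto simp: fsupp_def boundary_eq_fprod[OF assms])
qed

lemma boundary_comb:
  assumes "finite I" "\<And>i. i \<in> I \<Longrightarrow> fsupp (f i)"
  shows "boundary G (comb f e I) = comb (\<lambda>i. boundary G (f i)) e I"
proof
  fix ws
  have "boundary G (comb f e I) ws = (\<Otimes>i\<in>I. fprod (f i) (range (\<lambda>v. v # ws)) [^] e i)"
    using fprod_comb[OF assms] boundary_eq_fprod[OF fsupp_comb[OF assms]] by simp
  also have "\<dots> = comb (\<lambda>i. boundary G (f i)) e I ws"
    unfolding comb_def
    by (rule finprod_cong')
      (use assms(2) in \<open>auto simp: boundary_eq_fprod intro!: fprod_closed int_pow_closed\<close>)
  finally show "boundary G (comb f e I) ws = comb (\<lambda>i. boundary G (f i)) e I ws" .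
qed

lemma cycles_iff:
  "z \<in> cycles K G n \<longleftrightarrow> z \<in> carrier (chain_group K G n) \<and> (\<forall>ws. boundary G z ws = \<one>)"
  by (auto simp: cycles_def kernel_def chain_group_def)

lemma one_chain: "(\<lambda>_. \<one>) \<in> carrier (chain_group K G n)"
  by (auto simp: chain_group_def)

lemma boundary_one: "boundary G (\<lambda>_. \<one>) = (\<lambda>_. \<one>)"
  by (simp add: boundary_def fun_eq_iff)

text \<open>In a trivial quotient the coset of \<open>z\<close> is \<open>boundaries\<close> itself,
  and it contains \<open>z\<close> because the trivial chain is a boundary.\<close>

lemma trivial_homology_cycleD:
  assumes "trivial_group (reduced_homology K G n)" "z \<in> cycles K G n"
  obtains c where "c \<in> carrier (chain_group K G (n + 1))" "boundary G c = z"
proof -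
  let ?C = "(chain_group K G n)\<lparr>carrier := cycles K G n\<rparr>"
  have one: "(\<lambda>_. \<one>) \<in> boundaries K G n"
    unfolding boundaries_def by (rule image_eqI[where x = "\<lambda>_. \<one>"]) (simp_all add: boundary_one one_chain)
  have "boundaries K G n #>\<^bsub>?C\<^esub> z \<in> carrier (reduced_homology K G n)"
    using assms(2) by (auto simp: reduced_homology_def FactGroup_def RCOSETS_def)
  also have "\<dots> = {boundaries K G n}"
    using assms(1) by (simp add: trivial_group_def reduced_homology_def FactGroup_def)
  finally have eq: "boundaries K G n #>\<^bsub>?C\<^esub> z = boundaries K G n" by simp
  have "(\<lambda>xs. \<one> \<otimes> z xs) \<in> boundaries K G n #>\<^bsub>?C\<^esub> z"
    using one by (force simp: r_coset_def chain_group_def)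
  moreover have "(\<lambda>xs. \<one> \<otimes> z xs) = z"
    using assms(2) by (auto simp: cycles_iff chain_iff alternating_def)
  ultimately have "z \<in> boundaries K G n" using eq by simp
  then show thesis using that by (auto simp: boundaries_def)
qed

text \<open>In top degree there are no boundaries but the trivial one, so homology classes are cycles.\<close>

lemma top_homology_iso_cycle:
  assumes "reduced_homology K G n \<cong> G" "ordered_simplices K (n + 1) = {}"
    and "x \<in> carrier G" "x \<noteq> \<one>"
  obtains z where "z \<in> cycles K G n" "\<exists>xs. z xs \<noteq> \<one>"
    "(\<forall>xs. z xs \<otimes> z xs = \<one>) \<longrightarrow> x \<otimes> x = \<one>"
proof -
  let ?C = "(chain_group K G n)\<lparr>carrier := cycles K G n\<rparr>"
  let ?o = "\<lambda>_. \<one>" and ?H = "reduced_homology K G n"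
  have "carrier (chain_group K G (n + 1)) = {?o}"
    using assms(2) one_chain[of K "n + 1"] by (auto simp: chain_iff supp_def)
  then have B: "boundaries K G n = {?o}"
    by (simp add: boundaries_def boundary_one)
  have coset: "{?o} #>\<^bsub>?C\<^esub> z = {z}" if "z \<in> cycles K G n" for z
    using that by (auto simp: r_coset_def chain_group_def cycles_iff)
  have carr: "carrier ?H = (\<lambda>z. {z}) ` cycles K G n"
    using coset by (auto simp: reduced_homology_def FactGroup_def RCOSETS_def B)
  have mult: "{z} \<otimes>\<^bsub>?H\<^esub> {z'} = {\<lambda>xs. z xs \<otimes> z' xs}" for z z'
    by (simp add: reduced_homology_def FactGroup_def set_mult_def chain_group_def)
  obtain h where h: "h \<in> iso ?H G"
    using assms(1) by (auto simp: is_iso_def)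
  have hm: "h (X \<otimes>\<^bsub>?H\<^esub> Y) = h X \<otimes> h Y" "h X \<in> carrier G" if "X \<in> carrier ?H" "Y \<in> carrier ?H" for X Y
    using h that by (auto simp: iso_def hom_def)
  have o_cyc: "?o \<in> cycles K G n"
    by (simp add: cycles_iff one_chain boundary_one)
  then have oH: "{?o} \<in> carrier ?H" by (auto simp: carr)
  have "h {?o} \<otimes> h {?o} = h {?o}"
    using hm(1)[OF oH oH] mult[of ?o ?o] by simp
  then have h1: "h {?o} = \<one>" using hm(2)[OF oH oH] by simp
  \<comment> \<open>\<open>z\<close> represents the class corresponding to \<open>x\<close>: a
    trivial \<open>z\<close> would give \<open>x = \<one>\<close>, and if \<open>z\<close> squares
    to the trivial chain, then \<open>x\<close> squares to \<open>\<one>\<close>.\<close>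
  have "x \<in> h ` carrier ?H" using h assms(3) by (simp add: iso_def bij_betw_def)
  then obtain z where z: "z \<in> cycles K G n" "h {z} = x" unfolding carr by auto
  then have zH: "{z} \<in> carrier ?H" by (auto simp: carr)
  show thesis
  proof (rule that[OF z(1)])
    show "\<exists>xs. z xs \<noteq> \<one>"
    proof (rule ccontr)
      assume "\<not> ?thesis"
      then have "z = ?o" by auto
      then show False using z(2) h1 assms(4) by simp
    qed
    show "(\<forall>xs. z xs \<otimes> z xs = \<one>) \<longrightarrow> x \<otimes> x = \<one>"
    proof
      assume "\<forall>xs. z xs \<otimes> z xs = \<one>"
      then have "{z} \<otimes>\<^bsub>?H\<^esub> {z} = {?o}" by (simp add: mult)
      then show "x \<otimes> x = \<one>" using hm(1)[OF zH zH] z(2) h1 by simp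
    qed
  qed
qed

section \<open>Pushing chains forward along a map of vertices\<close>

text \<open>The map induced on chains by a vertex map, formed on lists. Degenerate images get no
  special treatment here; for alternating chains supported on lists without repetitions they cancel,
  by \<open>push_not_distinct\<close>.\<close>

definition push :: "('v \<Rightarrow> 'w) \<Rightarrow> ('v list \<Rightarrow> 'a) \<Rightarrow> 'w list \<Rightarrow> 'a" where
  "push f c ys = fprod c {xs. map f xs = ys}"

lemma push_neq_oneD: "push f c ys \<noteq> \<one> \<Longrightarrow> \<exists>xs. map f xs = ys \<and> c xs \<noteq> \<one>"
  using fprod_neq_oneD[of c "{xs. map f xs = ys}"] by (auto simp: push_def)

lemma push_closed: "fsupp c \<Longrightarrow> push f c ys \<in> carrier G"
  by (simp add: push_def fprod_closed)

lemma push_comb: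
  assumes "finite I" "\<And>i. i \<in> I \<Longrightarrow> fsupp (g i)"
  shows "push f (comb g e I) ys = comb (\<lambda>i. push f (g i)) e I ys"
  using fprod_comb[OF assms] by (simp add: push_def comb_def)

lemma permute_list_inv:
  assumes "p permutes {..<length xs}"
  shows "permute_list p (permute_list (inv_into UNIV p) xs) = xs"
    and "permute_list (inv_into UNIV p) (permute_list p xs) = xs"
proof -
  have q: "inv_into UNIV p permutes {..<length xs}" using assms by (rule permutes_inv)
  show "permute_list p (permute_list (inv_into UNIV p) xs) = xs"
    using permute_list_compose[OF assms, of "inv_into UNIV p"] permutes_inv_o(2)[OF assms] by simp
  show "permute_list (inv_into UNIV p) (permute_list p xs) = xs"
    using permute_list_compose[OF q, of p] permutes_inv_o(1)[OF assms] by simp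
qed

text \<open>Permuting by \<open>p\<close> is a bijection from the fibre over \<open>ys\<close> to
  the fibre over the permuted list, and it raises each coefficient to the power
  \<open>sign p\<close>.\<close>

lemma push_alternating:
  fixes c :: "'v list \<Rightarrow> 'a" and f :: "'v \<Rightarrow> 'w"
  assumes "alternating c" "finite (supp c)"
  shows "alternating (push f c)"
  unfolding alternating_def
proof (intro conjI allI impI)
  have fs: "fsupp c" using assms by (simp add: fsupp_def alternating_def)
  show "push f c ys \<in> carrier G" for ys by (rule push_closed[OF fs])
  fix ys :: "'w list" and p assume p: "p permutes {..<length ys}"
  let ?q = "inv_into UNIV p"
  let ?D = "{xs. map f xs = ys \<and> c xs \<noteq> \<one>}" and ?E = "{xs. map f xs = permute_list p ys \<and> c xs \<noteq> \<one>}"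
  have len: "length xs = length ys" if "map f xs = ys \<or> map f xs = permute_list p ys" for xs
    using that by (metis length_map length_permute_list)
  have cp: "c (permute_list p xs) = c xs [^] sign p" "c xs \<in> carrier G"
    if "length xs = length ys" for xs
    using assms(1) p that by (auto simp: alternating_def)
  have cp1: "c (permute_list p xs) = \<one> \<longleftrightarrow> c xs = \<one>" if "length xs = length ys" for xs
    by (cases p rule: sign_cases) (use cp[OF that] in \<open>auto simp: int_pow_neg\<close>)
  have E: "?E = permute_list p ` ?D"
  proof (intro equalityI subsetI)
    fix xs assume xs: "xs \<in> ?E"
    then have l: "length xs = length ys" using len by blast
    have eq: "permute_list p (permute_list ?q xs) = xs" by (rule permute_list_inv) (simp add: l p)
    have q: "?q permutes {..<length xs}" using permutes_inv[OF p] l by simp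
    have "map f (permute_list ?q xs) = permute_list ?q (permute_list p ys)"
      using xs permute_list_map[OF q, of f] by simp
    also have "\<dots> = ys" by (rule permute_list_inv(2)[OF p])
    finally have "map f (permute_list ?q xs) = ys" .
    moreover have "c (permute_list ?q xs) \<noteq> \<one>"
      using cp1[of "permute_list ?q xs"] xs l eq by simp
    ultimately show "xs \<in> permute_list p ` ?D" using eq by (metis (mono_tags, lifting) image_eqI mem_Collect_eq)
  next
    fix xs assume "xs \<in> permute_list p ` ?D"
    then obtain us where us: "xs = permute_list p us" "map f us = ys" "c us \<noteq> \<one>" by blast
    then have "length us = length ys" using len by blast
    then show "xs \<in> ?E" using us cp1[of us] p permute_list_map[of p us f] by simp
  qed
  have inj: "inj_on (permute_list p) ?D"
  proof (rule inj_onI)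
    fix xs us assume "xs \<in> ?D" "us \<in> ?D" "permute_list p xs = permute_list p us"
    moreover have "length xs = length ys" "length us = length ys" using calculation len by blast+
    ultimately show "xs = us" using permute_list_inv(2)[of p] p by metis
  qed
  have "push f c (permute_list p ys) = finprod G c ?E"
    by (simp add: push_def fprod_def)
  also have "\<dots> = (\<Otimes>xs\<in>?D. c (permute_list p xs))"
    unfolding E by (rule finprod_reindex) (use inj assms(1) in \<open>auto simp: alternating_def\<close>)
  also have "\<dots> = (\<Otimes>xs\<in>?D. c xs [^] sign p)"
    by (rule finprod_cong') (use cp len in auto)
  also have "\<dots> = push f c ys [^] sign p"
    unfolding push_def fprod_def
    by (subst finprod_int_pow) (use assms(1) in \<open>auto simp: alternating_def\<close>)
  finally show "push f c (permute_list p ys) = push f c ys [^] sign p" .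
qed

text \<open>Transposing two positions of equal image is a fixed-point free involution of the fibre that
  inverts the coefficients.\<close>

lemma push_not_distinct:
  assumes "alternating c" "finite (supp c)" "\<And>xs. c xs \<noteq> \<one> \<Longrightarrow> distinct xs" "\<not> distinct ys"
  shows "push f c ys = \<one>"
proof -
  obtain i j where ij: "i < length ys" "j < length ys" "i \<noteq> j" "ys ! i = ys ! j"
    using assms(4) by (auto simp: distinct_conv_nth)
  let ?t = "transpose i j" and ?D = "{xs. map f xs = ys \<and> c xs \<noteq> \<one>}"
  have p: "?t permutes {..<length ys}" using ij by (intro permutes_swap_id) auto
  have "finprod G c ?D = \<one>"
  proof (rule finprod_involution[where s = "permute_list ?t"])
    show "finite ?D" by (rule finite_subset[OF _ assms(2)]) (auto simp: supp_def)
    show "c \<in> ?D \<rightarrow> carrier G" using assms(1) by (auto simp: alternating_def)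
    fix xs assume xs: "xs \<in> ?D"
    then have l: "length xs = length ys" by auto
    have px: "?t permutes {..<length xs}" using p l by simp
    show inv: "c (permute_list ?t xs) = inv c xs"
      by (rule alternating_swap_nth[OF assms(1)]) (use ij l in auto)
    have "permute_list ?t ys = ys"
    proof (rule nth_equalityI)
      fix k assume "k < length (permute_list ?t ys)"
      then show "permute_list ?t ys ! k = ys ! k"
        using permute_list_nth[OF p, of k] ij(4) by (simp add: transpose_def)
    qed simp
    then have "map f (permute_list ?t xs) = ys" using xs permute_list_map[OF px, of f] by simp
    moreover have "c (permute_list ?t xs) \<noteq> \<one>"
      using xs inv assms(1) by (simp add: alternating_def)
    ultimately show "permute_list ?t xs \<in> ?D" by simp
    have "permute_list ?t (permute_list ?t xs) = permute_list (?t \<circ> ?t) xs"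
      by (rule permute_list_compose[OF px, symmetric])
    then show "permute_list ?t (permute_list ?t xs) = xs" by simp
    have "distinct xs" using xs assms(3) by blast
    then have "xs ! i \<noteq> xs ! j" using ij l by (simp add: nth_eq_iff_index_eq)
    moreover have "permute_list ?t xs ! i = xs ! j" using permute_list_nth[OF px, of i] ij l by simp
    ultimately show "permute_list ?t xs \<noteq> xs" by metis
  qed
  then show ?thesis by (simp add: push_def fprod_def)
qed

text \<open>Both sides multiply \<open>c\<close> over all nonempty lists whose tail maps to
  \<open>ws\<close>: grouped by tail on the left, by the image of the head on the right.\<close>

lemma push_boundary:
  assumes "fsupp c" "finite U" "\<And>xs. c xs \<noteq> \<one> \<Longrightarrow> f ` set xs \<subseteq> U"
  shows "push f (boundary G c) ws = (\<Otimes>u\<in>U. push f c (u # ws))"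
proof -
  let ?D = "{zs. zs \<noteq> [] \<and> map f (tl zs) = ws}"
  \<comment> \<open>The first set covers the support of the boundary. The second covers the tails in
    the support of \<open>c\<close>, including those at which the coefficients cancel.\<close>
  let ?Y = "{xs \<in> supp (boundary G c). map f xs = ws} \<union> {xs \<in> tl ` supp c. map f xs = ws}"
  have bs: "fsupp (boundary G c)" by (rule boundary_fsupp[OF assms(1)])
  have fin: "finite ?Y" using assms(1) bs by (auto simp: fsupp_def)
  have "push f (boundary G c) ws = finprod G (boundary G c) ?Y"
    unfolding push_def by (rule fprod_eq_finprod[OF bs fin]) auto
  also have "\<dots> = (\<Otimes>xs\<in>?Y. fprod c {zs \<in> ?D. tl zs = xs})"
  proof (rule finprod_cong'[OF refl])
    fix xs assume "xs \<in> ?Y"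
    then have "map f xs = ws" by blast
    then have "{zs \<in> ?D. tl zs = xs} = range (\<lambda>v. v # xs)"
      by (auto simp: neq_Nil_conv)
    then show "boundary G c xs = fprod c {zs \<in> ?D. tl zs = xs}"
      by (simp add: boundary_eq_fprod[OF assms(1)])
  qed (use fprod_closed[OF assms(1)] in auto)
  also have "\<dots> = fprod c ?D"
    by (rule fprod_partition[symmetric, OF assms(1) fin]) auto
  also have "\<dots> = (\<Otimes>u\<in>U. fprod c {zs \<in> ?D. f (hd zs) = u})"
    by (rule fprod_partition[OF assms(1,2)])
      (use assms(3) in \<open>force simp: supp_def neq_Nil_conv\<close>)
  also have "\<dots> = (\<Otimes>u\<in>U. push f c (u # ws))"
  proof (rule finprod_cong'[OF refl])
    fix u
    have "{zs \<in> ?D. f (hd zs) = u} = {zs. map f zs = u # ws}"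
      by (auto simp: neq_Nil_conv)
    then show "fprod c {zs \<in> ?D. f (hd zs) = u} = push f c (u # ws)" by (simp add: push_def)
  qed (use push_closed[OF assms(1)] in auto)
  finally show ?thesis .
qed

end

section \<open>Ordered vertices and signs\<close>

text \<open>The incidence number of the face \<open>\<sigma> - {i}\<close> in \<open>\<sigma>\<close>.\<close>

definition pos_sign :: "'v::linorder \<Rightarrow> 'v set \<Rightarrow> int" where
  "pos_sign i \<sigma> = (- 1) ^ card {j \<in> \<sigma>. j < i}"

lemma pos_sign_cases: "pos_sign i \<sigma> = 1 \<or> pos_sign i \<sigma> = - 1"
  by (cases "even (card {j \<in> \<sigma>. j < i})") (simp_all add: pos_sign_def)

text \<open>Removing the smaller vertex shifts the position of the larger one by one, while removing
  the larger vertex leaves the smaller one in place.\<close>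

lemma pos_sign_remove_less:
  assumes "finite \<sigma>" "i \<in> \<sigma>" "i < j"
  shows "pos_sign j (\<sigma> - {i}) * pos_sign i \<sigma> = - (pos_sign i (\<sigma> - {j}) * pos_sign j \<sigma>)"
proof -
  have "{k \<in> \<sigma>. k < j} = insert i {k \<in> \<sigma> - {i}. k < j}" using assms by auto
  then have "card {k \<in> \<sigma>. k < j} = Suc (card {k \<in> \<sigma> - {i}. k < j})"
    using assms(1) by simp
  moreover have "{k \<in> \<sigma> - {j}. k < i} = {k \<in> \<sigma>. k < i}" using assms by auto
  ultimately show ?thesis by (simp add: pos_sign_def)
qed

lemma pos_sign_remove:
  assumes "finite \<sigma>" "i \<in> \<sigma>" "j \<in> \<sigma>" "i \<noteq> j"
  shows "pos_sign i (\<sigma> - {j}) * pos_sign j \<sigma> = - (pos_sign j (\<sigma> - {i}) * pos_sign i \<sigma>)"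
  using assms pos_sign_remove_less[of \<sigma> i j] pos_sign_remove_less[of \<sigma> j i]
  by (cases "i < j") auto

lemma insort_eq_takeWhile:
  "insort v ws = takeWhile (\<lambda>w. w < v) ws @ v # dropWhile (\<lambda>w. w < v) ws"
  by (induction ws) auto

lemma length_takeWhile_sorted:
  assumes "sorted ws" "distinct ws"
  shows "length (takeWhile (\<lambda>w. w < v) ws) = card {w \<in> set ws. w < v}"
proof -
  have "takeWhile (\<lambda>w. w < v) ws = filter (\<lambda>w. w < v) ws"
    using assms(1) by (induction ws) (auto intro!: filter_False[symmetric] dest: order.strict_trans1)
  then show ?thesis
    using distinct_card[of "filter (\<lambda>w. w < v) ws"] assms(2) by simp
qed

context comm_group
begin

text \<open>Translates between the convention of \<open>boundary\<close>, where the vertex opposite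
  a face comes first, and incidence numbers.\<close>

lemma alternating_Cons_sorted:
  assumes "alternating c" "finite \<rho>" "v \<notin> \<rho>"
  shows "c (v # sorted_list_of_set \<rho>)
    = c (sorted_list_of_set (insert v \<rho>)) [^] pos_sign v (insert v \<rho>)"
proof -
  let ?ws = "sorted_list_of_set \<rho>"
  let ?us = "takeWhile (\<lambda>w. w < v) ?ws" and ?vs = "dropWhile (\<lambda>w. w < v) ?ws"
  have "sorted_list_of_set (insert v \<rho>) = ?us @ v # ?vs"
    using assms by (simp add: insort_eq_takeWhile)
  moreover have "length ?us = card {w \<in> insert v \<rho>. w < v}"
    using assms(2) by (subst length_takeWhile_sorted) (auto intro: arg_cong[where f = card])
  ultimately show ?thesis
    using alternating_move[OF assms(1), of v ?us ?vs] by (simp add: pos_sign_def)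
qed

text \<open>Every list without repetitions is a permutation of a sorted one. Lists with repetitions
  need their own hypothesis: there alternation only forces coefficients of order at most 2.\<close>

lemma alternating_ext:
  assumes "alternating y" "alternating z"
    and "\<And>xs. \<not> distinct xs \<Longrightarrow> y xs = z xs"
    and "\<And>\<sigma>. finite \<sigma> \<Longrightarrow> y (sorted_list_of_set \<sigma>) = z (sorted_list_of_set \<sigma>)"
  shows "y = z"
proof
  fix xs
  show "y xs = z xs"
  proof (cases "distinct xs")
    case True
    let ?s = "sorted_list_of_set (set xs)"
    have "mset xs = mset ?s"
      using True by (subst set_eq_iff_mset_eq_distinct[symmetric]) auto
    then obtain p where "p permutes {..<length ?s}" "permute_list p ?s = xs"
      by (rule mset_eq_permutation)
    then show ?thesis
      using assms(1,2) assms(4)[of "set xs"] unfolding alternating_def by (metis finite_set)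
  qed (rule assms(3))
qed

lemma alternating_same_set:
  assumes "alternating c" "distinct xs" "distinct ys" "set xs = set ys"
  shows "c ys = c xs \<or> c ys = inv (c xs)"
  using alternating_mset_cases[OF assms(1)] assms(2-) set_eq_iff_mset_eq_distinct by blast

end

section \<open>Cycles of a pseudomanifold\<close>

text \<open>Finiteness of the vertex set guarantees that every simplex lies in a facet.\<close>

locale pseudomfd =
  fixes d :: nat and M :: "nat set set"
  assumes pm: "pseudomanifold d M" and fin: "finite (vertices M)"
begin

lemma finite_complex: "finite M"
  using fin by (simp add: vertices_def finite_UnionD)

lemma simplexD:
  assumes "\<sigma> \<in> M"
  shows "finite \<sigma>" "\<sigma> \<noteq> {}" "\<And>\<tau>. \<tau> \<subseteq> \<sigma> \<Longrightarrow> \<tau> \<noteq> {} \<Longrightarrow> \<tau> \<in> M"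
  using pm assms unfolding pseudomanifold_def simplicial_complex_def by blast+

lemma facet_card: "facet M \<sigma> \<Longrightarrow> card \<sigma> = d + 1"
  using pm by (simp add: pseudomanifold_def pure_of_dim_def has_dim_def)

lemma facetD: "facet M \<sigma> \<Longrightarrow> \<sigma> \<in> M"
  by (simp add: facet_def)

lemma in_facet:
  assumes "\<sigma> \<in> M"
  obtains \<tau> where "facet M \<tau>" "\<sigma> \<subseteq> \<tau>"
proof -
  have "finite {\<tau> \<in> M. \<sigma> \<subseteq> \<tau>}" "{\<tau> \<in> M. \<sigma> \<subseteq> \<tau>} \<noteq> {}"
    using finite_complex assms by auto
  from finite_has_maximal[OF this] obtain \<tau> where "\<tau> \<in> M" "\<sigma> \<subseteq> \<tau>"
    "\<forall>\<tau>'\<in>{\<tau> \<in> M. \<sigma> \<subseteq> \<tau>}. \<tau> \<subseteq> \<tau>' \<longrightarrow> \<tau> = \<tau>'" by blast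
  then have "facet M \<tau>" unfolding facet_def by blast
  then show thesis using that \<open>\<sigma> \<subseteq> \<tau>\<close> by blast
qed

lemma card_simplex: "\<sigma> \<in> M \<Longrightarrow> card \<sigma> \<le> d + 1"
  using in_facet[of \<sigma>] facet_card facetD simplexD(1) card_mono by metis

lemma facet_iff: "facet M \<sigma> \<longleftrightarrow> \<sigma> \<in> M \<and> card \<sigma> = d + 1"
proof
  assume \<sigma>: "\<sigma> \<in> M \<and> card \<sigma> = d + 1"
  then obtain \<tau> where \<tau>: "facet M \<tau>" "\<sigma> \<subseteq> \<tau>" using in_facet by blast
  then have "\<sigma> = \<tau>"
    using card_subset_eq[of \<tau> \<sigma>] facet_card[of \<tau>] simplexD(1)[of \<tau>] facetD[of \<tau>] \<sigma> by simp
  then show "facet M \<sigma>" using \<tau> by simp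
qed (simp add: facet_card facetD)

lemma top_simplex_facet:
  assumes "xs \<in> ordered_simplices M (int d)"
  shows "facet M (set xs)" "distinct xs"
  using assms by (auto simp: ordered_simplices_def facet_iff distinct_card)

lemma ordered_simplices_above: "ordered_simplices M (int d + 1) = {}"
  using card_simplex by (fastforce simp: ordered_simplices_def distinct_card[symmetric])

text \<open>By purity a facet above a ridge has exactly one more vertex, and non-branching leaves
  two such facets. For \<open>d = 0\<close> the ridge is empty and the facets are two
  points.\<close>

lemma ridge_facets:
  assumes "ridge M \<rho>"
  obtains u v where "u \<noteq> v" "u \<notin> \<rho>" "v \<notin> \<rho>" "finite \<rho>" "card \<rho> = d"
    "{\<tau>. facet M \<tau> \<and> \<rho> \<subseteq> \<tau>} = {insert u \<rho>, insert v \<rho>}"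
proof -
  let ?F = "{\<tau>. facet M \<tau> \<and> \<rho> \<subseteq> \<tau>}"
  from assms obtain \<tau>0 where \<tau>0: "facet M \<tau>0" "\<rho> \<subseteq> \<tau>0" "card \<tau>0 = card \<rho> + 1"
    by (auto simp: ridge_def)
  have fin\<rho>: "finite \<rho>" using \<tau>0 simplexD(1)[OF facetD] finite_subset by blast
  have c: "card \<rho> = d" using \<tau>0 facet_card by fastforce
  have ins: "\<exists>u. u \<notin> \<rho> \<and> \<tau> = insert u \<rho>" if "\<tau> \<in> ?F" for \<tau>
  proof -
    have "finite \<tau>" "card \<tau> = d + 1" using that simplexD(1)[OF facetD] facet_card by auto
    then have "card (\<tau> - \<rho>) = 1" using c fin\<rho> that by (simp add: card_Diff_subset)
    then obtain u where "\<tau> - \<rho> = {u}" by (auto simp: card_1_singleton_iff)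
    then have "u \<notin> \<rho> \<and> \<tau> = insert u \<rho>" using that by auto
    then show ?thesis ..
  qed
  have "card ?F = 2"
    using pm assms by (simp add: pseudomanifold_def non_branching_def)
  then obtain \<sigma> \<tau> where F: "?F = {\<sigma>, \<tau>}" "\<sigma> \<noteq> \<tau>" by (auto simp: card_2_iff)
  then obtain u v where "u \<notin> \<rho>" "\<sigma> = insert u \<rho>" "v \<notin> \<rho>" "\<tau> = insert v \<rho>"
    using ins[of \<sigma>] ins[of \<tau>] by blast
  then show thesis using that[of u v] F fin\<rho> c by auto
qed

lemma ridge_remove: "facet M \<sigma> \<Longrightarrow> i \<in> \<sigma> \<Longrightarrow> ridge M (\<sigma> - {i})"
  unfolding ridge_def
  using card_Suc_Diff1[of \<sigma> i] simplexD(1)[of \<sigma>] facetD[of \<sigma>] by (intro exI[of _ \<sigma>]) auto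

lemma facets_connected: "facet M \<sigma> \<Longrightarrow> facet M \<tau> \<Longrightarrow> (dual_adjacent M)\<^sup>*\<^sup>* \<sigma> \<tau>"
  using pm by (simp add: pseudomanifold_def strongly_connected_def)

text \<open>A facet above \<open>set ws\<close> adds \<open>u\<close> or \<open>v\<close>, and
  \<open>z\<close> lives on facets only, so the boundary at \<open>ws\<close> has no other
  factors.\<close>

lemma cycle_at_ridge:
  fixes G (structure)
  assumes "comm_group G" and z: "z \<in> cycles M G (int d)"
    and F: "{\<tau>. facet M \<tau> \<and> set ws \<subseteq> \<tau>} = {insert u (set ws), insert v (set ws)}"
    and "u \<noteq> v" "u \<notin> set ws" "v \<notin> set ws"
  shows "z (u # ws) \<otimes> z (v # ws) = \<one>"
proof -
  interpret comm_group G by fact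
  have ch: "z \<in> carrier (chain_group M G (int d))" and b: "boundary G z ws = \<one>"
    using z by (auto simp: cycles_iff)
  have cl: "z xs \<in> carrier G" for xs using ch by (simp add: chain_iff alternating_def)
  have sub: "{x. z (x # ws) \<noteq> \<one>} \<subseteq> {u, v}"
  proof
    fix x assume "x \<in> {x. z (x # ws) \<noteq> \<one>}"
    then have "x # ws \<in> ordered_simplices M (int d)" using ch by (auto simp: chain_iff supp_def)
    then have "facet M (insert x (set ws))" "x \<notin> set ws"
      using top_simplex_facet[of "x # ws"] by auto
    then have "insert x (set ws) \<in> {insert u (set ws), insert v (set ws)}"
      unfolding F[symmetric] by auto
    then show "x \<in> {u, v}" using \<open>x \<notin> set ws\<close> by auto
  qed
  have "boundary G z ws = (\<Otimes>x\<in>{u, v}. z (x # ws))"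
    unfolding boundary_def
    by (rule finprod_mono_neutral_cong_left) (use sub cl in auto)
  also have "\<dots> = z (u # ws) \<otimes> z (v # ws)"
    using assms(4) cl by simp
  finally show ?thesis using b by simp
qed

text \<open>Crossing a ridge inverts the coefficient, if both facets are listed with the vertex off
  the ridge first. Connectedness of the dual graph carries \<open>z xs0\<close> to every facet, up
  to inversion.\<close>

lemma cycle_values:
  fixes G (structure)
  assumes "comm_group G" and z: "z \<in> cycles M G (int d)" and xs0: "z xs0 \<noteq> \<one>"
    and xs: "distinct xs" "facet M (set xs)"
  shows "z xs \<in> {z xs0, inv (z xs0)}"
proof -
  interpret comm_group G by fact
  have ch: "z \<in> carrier (chain_group M G (int d))" using z by (simp add: cycles_iff)
  then have alt: "alternating z" by (simp add: chain_iff)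
  have cl: "z xs \<in> carrier G" for xs using alt by (simp add: alternating_def)
  have "xs0 \<in> ordered_simplices M (int d)" using ch xs0 by (auto simp: chain_iff supp_def)
  note f0 = top_simplex_facet[OF this]
  have *: "z us \<in> {z xs0, inv (z xs0)}" if "z ws \<in> {z xs0, inv (z xs0)}"
    "distinct ws" "distinct us" "set ws = set us" for us ws
    using alternating_same_set[OF alt that(2-)] that(1) cl by auto
  \<comment> \<open>All orderings of a facet are treated at once, because each crossing requires the
    vertex off the current ridge to come first.\<close>
  have "\<forall>xs. distinct xs \<and> set xs = \<tau> \<longrightarrow> z xs \<in> {z xs0, inv (z xs0)}"
    if "(dual_adjacent M)\<^sup>*\<^sup>* (set xs0) \<tau>" for \<tau>
    using that
  proof (induction rule: rtranclp_induct)
    case base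
    then show ?case using *[of xs0] f0 by blast
  next
    case (step \<sigma> \<tau>)
    then obtain \<rho> where \<rho>: "ridge M \<rho>" "\<rho> \<subseteq> \<sigma>" "\<rho> \<subseteq> \<tau>" "\<sigma> \<noteq> \<tau>" "facet M \<sigma>" "facet M \<tau>"
      by (auto simp: dual_adjacent_def)
    obtain u v where uv: "u \<noteq> v" "u \<notin> \<rho>" "v \<notin> \<rho>" "finite \<rho>"
      "{\<tau>. facet M \<tau> \<and> \<rho> \<subseteq> \<tau>} = {insert u \<rho>, insert v \<rho>}"
      using ridge_facets[OF \<rho>(1)] by metis
    let ?ws = "sorted_list_of_set \<rho>"
    have st: "{\<sigma>, \<tau>} \<subseteq> {insert u \<rho>, insert v \<rho>}" using \<rho> unfolding uv(5)[symmetric] by auto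
    have prod: "z (u # ?ws) \<otimes> z (v # ?ws) = \<one>"
      by (rule cycle_at_ridge[OF assms(1) z]) (use uv in auto)
    then have inv1: "z (u # ?ws) = inv (z (v # ?ws))" "z (v # ?ws) = inv (z (u # ?ws))"
      using cl by (auto intro: inv_equality[symmetric] simp: m_comm)
    consider "\<sigma> = insert u \<rho>" "\<tau> = insert v \<rho>" | "\<sigma> = insert v \<rho>" "\<tau> = insert u \<rho>"
      using st \<rho>(4) by auto
    then obtain x y where xy: "\<sigma> = insert x \<rho>" "\<tau> = insert y \<rho>" "x \<notin> \<rho>" "y \<notin> \<rho>"
      "z (y # ?ws) = inv (z (x # ?ws))"
      using uv(2,3) inv1 by metis
    then have "z (x # ?ws) \<in> {z xs0, inv (z xs0)}"
      using step.IH uv(4) by simp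
    then have "z (y # ?ws) \<in> {z xs0, inv (z xs0)}"
      using xy(5) cl by auto
    then show ?case using *[of "y # ?ws"] xy uv(4) by auto
  qed
  then show ?thesis using facets_connected[OF f0(1) xs(2)] xs(1) by blast
qed

end

section \<open>Filling the simplices of a complex by acyclic carriers\<close>

context comm_group
begin

lemma chain_mono: "K \<subseteq> L \<Longrightarrow> c \<in> carrier (chain_group K G n) \<Longrightarrow> c \<in> carrier (chain_group L G n)"
  by (auto simp: chain_iff ordered_simplices_def)

text \<open>Each face of codimension two is reached in two orders of removal, with opposite signs by
  \<open>pos_sign_remove\<close>.\<close>

lemma double_boundary:
  assumes "finite \<sigma>" "\<And>\<tau>. \<tau> \<subseteq> \<sigma> \<Longrightarrow> fsupp (\<phi> \<tau>)"
    and "\<And>i. i \<in> \<sigma> \<Longrightarrow> boundary G (\<phi> (\<sigma> - {i})) =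
      comb (\<lambda>j. \<phi> (\<sigma> - {i} - {j})) (\<lambda>j. pos_sign j (\<sigma> - {i})) (\<sigma> - {i})"
  shows "boundary G (comb (\<lambda>i. \<phi> (\<sigma> - {i})) (\<lambda>i. pos_sign i \<sigma>) \<sigma>) ws = \<one>"
proof -
  have cl: "\<phi> (\<sigma> - {i} - {j}) ws \<in> carrier G" for i j
    using assms(2)[of "\<sigma> - {i} - {j}"] by (auto simp: fsupp_def)
  \<comment> \<open>The diagonal, where only one vertex is removed, is filled with
    \<open>\<one>\<close> to obtain a square array.\<close>
  define g where "g i j = (if i = j then \<one>
      else \<phi> (\<sigma> - {i} - {j}) ws [^] (pos_sign j (\<sigma> - {i}) * pos_sign i \<sigma>))" for i j
  have "boundary G (comb (\<lambda>i. \<phi> (\<sigma> - {i})) (\<lambda>i. pos_sign i \<sigma>) \<sigma>) ws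
      = comb (\<lambda>i. boundary G (\<phi> (\<sigma> - {i}))) (\<lambda>i. pos_sign i \<sigma>) \<sigma> ws"
    using boundary_comb[OF assms(1), of "\<lambda>i. \<phi> (\<sigma> - {i})"] assms(2) by simp
  also have "\<dots> = (\<Otimes>i\<in>\<sigma>. \<Otimes>j\<in>\<sigma>. g i j)"
    unfolding comb_def
  proof (rule finprod_cong'[OF refl])
    fix i assume i: "i \<in> \<sigma>"
    have "boundary G (\<phi> (\<sigma> - {i})) ws [^] pos_sign i \<sigma>
        = (\<Otimes>j\<in>\<sigma> - {i}. (\<phi> (\<sigma> - {i} - {j}) ws [^] pos_sign j (\<sigma> - {i})) [^] pos_sign i \<sigma>)"
      unfolding assms(3)[OF i] comb_def by (rule finprod_int_pow) (use cl in auto)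
    also have "\<dots> = (\<Otimes>j\<in>\<sigma>. g i j)"
      by (rule finprod_mono_neutral_cong_left) (use assms(1) cl in \<open>auto simp: g_def int_pow_pow\<close>)
    finally show "boundary G (\<phi> (\<sigma> - {i})) ws [^] pos_sign i \<sigma> = (\<Otimes>j\<in>\<sigma>. g i j)" .
  qed (use cl in \<open>auto simp: g_def intro!: finprod_closed\<close>)
  also have "\<dots> = \<one>"
  proof (rule finprod_antisymmetric[OF assms(1)])
    fix i j assume ij: "i \<in> \<sigma>" "j \<in> \<sigma>"
    show "g i j \<in> carrier G" using cl by (simp add: g_def)
    show "g i i = \<one>" by (simp add: g_def)
    have "\<sigma> - {j} - {i} = \<sigma> - {i} - {j}" by auto
    then show "g j i = inv (g i j)"
      using pos_sign_remove[OF assms(1) ij] cl by (simp add: g_def int_pow_neg)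
  qed
  finally show ?thesis .
qed

lemma comb_cong:
  assumes "\<And>i. i \<in> I \<Longrightarrow> f i = g i" "\<And>i x. i \<in> I \<Longrightarrow> g i x \<in> carrier G"
  shows "comb f e I = comb g e I"
  unfolding comb_def by (intro ext finprod_cong') (use assms in auto)

text \<open>Induction on the number of vertices. The signed combination of the fillings of the faces
  of \<sigma> is a chain of \<open>L \<sigma>\<close> by monotonicity and a cycle by
  \<open>double_boundary\<close>; its degree is \<open>card \<sigma> - 2\<close>, so acyclicity
  supplies a filling. For a vertex this degree is \<open>-1\<close>, and it is the coefficient
  \<open>a\<close> on the empty list that gets filled. \<open>N\<close> makes finitely many stages
  suffice.\<close>

lemma acyclic_carrier_chains:
  fixes M :: "'i::linorder set set" and L :: "'i set \<Rightarrow> 'v set set"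
  assumes M: "simplicial_complex M" and a: "a \<in> carrier G"
    and acyclic: "\<And>\<sigma>. \<sigma> \<in> M \<Longrightarrow> trivial_group (reduced_homology (L \<sigma>) G (int (card \<sigma>) - 2))"
    and mono: "\<And>\<sigma> \<tau>. \<tau> \<subseteq> \<sigma> \<Longrightarrow> L \<tau> \<subseteq> L \<sigma>"
    and bound: "\<And>\<sigma>. \<sigma> \<in> M \<Longrightarrow> card \<sigma> \<le> N"
  obtains \<phi> where "\<phi> {} = (\<lambda>xs. if xs = [] then a else \<one>)"
    "\<And>\<sigma>. \<sigma> \<in> insert {} M \<Longrightarrow> \<phi> \<sigma> \<in> carrier (chain_group (L \<sigma>) G (int (card \<sigma>) - 1))"
    "\<And>\<sigma>. \<sigma> \<in> insert {} M \<Longrightarrow>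
       boundary G (\<phi> \<sigma>) = comb (\<lambda>i. \<phi> (\<sigma> - {i})) (\<lambda>i. pos_sign i \<sigma>) \<sigma>"
proof -
  let ?e = "\<lambda>xs :: 'v list. if xs = [] then a else \<one>"
  define good where "good \<phi> \<sigma> \<longleftrightarrow> \<phi> \<sigma> \<in> carrier (chain_group (L \<sigma>) G (int (card \<sigma>) - 1)) \<and>
    boundary G (\<phi> \<sigma>) = comb (\<lambda>i. \<phi> (\<sigma> - {i})) (\<lambda>i. pos_sign i \<sigma>) \<sigma>" for \<phi> \<sigma>
  have finM: "finite \<sigma>" "\<And>\<tau>. \<tau> \<subseteq> \<sigma> \<Longrightarrow> \<tau> \<in> insert {} M" if "\<sigma> \<in> insert {} M" for \<sigma>
    using M that by (auto simp: simplicial_complex_def)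
  have "\<exists>\<phi>. \<phi> {} = ?e \<and> (\<forall>\<sigma>\<in>insert {} M. card \<sigma> \<le> n \<longrightarrow> good \<phi> \<sigma>)" for n
  proof (induction n)
    case 0
    have "?e \<in> carrier (chain_group (L {}) G (- 1))"
      using a by (auto simp: chain_group_def ordered_simplices_def permute_list_def)
    moreover have "boundary G ?e = (\<lambda>_. \<one>)" by (simp add: boundary_def fun_eq_iff)
    ultimately have "good (\<lambda>_. ?e) {}" by (simp add: good_def comb_def)
    then have "good (\<lambda>_. ?e) \<sigma>" if "\<sigma> \<in> insert {} M" "card \<sigma> \<le> 0" for \<sigma>
      using that(2) finM(1)[OF that(1)] by simp
    then show ?case by (intro exI[of _ "\<lambda>_. ?e"]) simp
  next
    case (Suc n)
    then obtain \<phi> where \<phi>: "\<phi> {} = ?e"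
      "\<And>\<sigma>. \<sigma> \<in> insert {} M \<Longrightarrow> card \<sigma> \<le> n \<Longrightarrow> good \<phi> \<sigma>" by blast
    define r where "r \<sigma> = comb (\<lambda>i. \<phi> (\<sigma> - {i})) (\<lambda>i. pos_sign i \<sigma>) \<sigma>" for \<sigma>
    have ex: "\<exists>c. c \<in> carrier (chain_group (L \<sigma>) G (int n)) \<and> boundary G c = r \<sigma>"
      if \<sigma>: "\<sigma> \<in> M" "card \<sigma> = Suc n" for \<sigma>
    proof -
      have fin: "finite \<sigma>" and sub: "\<And>\<tau>. \<tau> \<subseteq> \<sigma> \<Longrightarrow> \<tau> \<in> insert {} M" using finM[of \<sigma>] \<sigma>(1) by auto
      have g: "good \<phi> (\<sigma> - {i})" "card (\<sigma> - {i}) = n" if "i \<in> \<sigma>" for i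
        using \<phi>(2)[OF sub[of "\<sigma> - {i}"]] that \<sigma>(2) fin by auto
      have ch: "\<phi> (\<sigma> - {i}) \<in> carrier (chain_group (L \<sigma>) G (int n - 1))" if "i \<in> \<sigma>" for i
        using g[OF that] chain_mono[OF mono[of "\<sigma> - {i}" \<sigma>]] by (auto simp: good_def)
      have fs: "fsupp (\<phi> \<tau>)" if "\<tau> \<subset> \<sigma>" for \<tau>
      proof -
        have "card \<tau> \<le> n" using psubset_card_mono[OF fin that] \<sigma>(2) by simp
        then have "good \<phi> \<tau>" using \<phi>(2) sub that by blast
        then show ?thesis using chain_fsupp by (auto simp: good_def)
      qed
      have "r \<sigma> \<in> carrier (chain_group (L \<sigma>) G (int n - 1))"
        unfolding r_def by (rule chain_comb[OF fin ch])
      moreover have "boundary G (r \<sigma>) ws = \<one>" for ws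
      proof -
        \<comment> \<open>At \<sigma> itself nothing is known about \<phi> yet, while
          \<open>double_boundary\<close> asks for finite support on all subsets. The trivial chain
          is put there; proper faces are unaffected.\<close>
        let ?\<phi> = "\<phi>(\<sigma> := \<lambda>_. \<one>)"
        have eq: "?\<phi> (\<sigma> - {i}) = \<phi> (\<sigma> - {i})" "?\<phi> (\<sigma> - {i} - {j}) = \<phi> (\<sigma> - {i} - {j})"
          if "i \<in> \<sigma>" for i j using that by auto
        have "r \<sigma> = comb (\<lambda>i. ?\<phi> (\<sigma> - {i})) (\<lambda>i. pos_sign i \<sigma>) \<sigma>"
          unfolding r_def
          by (rule comb_cong[symmetric]) (use eq(1) ch in \<open>auto simp: chain_iff alternating_def\<close>)
        moreover have "boundary G (comb (\<lambda>i. ?\<phi> (\<sigma> - {i})) (\<lambda>i. pos_sign i \<sigma>) \<sigma>) ws = \<one>"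
        proof (rule double_boundary[OF fin])
          show "fsupp (?\<phi> \<tau>)" if "\<tau> \<subseteq> \<sigma>" for \<tau>
            using fs[of \<tau>] that by (auto simp: fsupp_def supp_def)
          show "boundary G (?\<phi> (\<sigma> - {i})) =
              comb (\<lambda>j. ?\<phi> (\<sigma> - {i} - {j})) (\<lambda>j. pos_sign j (\<sigma> - {i})) (\<sigma> - {i})" if "i \<in> \<sigma>" for i
            using g(1)[OF that] eq[OF that] by (simp add: good_def)
        qed
        ultimately show ?thesis by simp
      qed
      ultimately have "r \<sigma> \<in> cycles (L \<sigma>) G (int n - 1)" by (simp add: cycles_iff)
      then show ?thesis
        using trivial_homology_cycleD[of "L \<sigma>" "int n - 1" "r \<sigma>"] acyclic[OF \<sigma>(1)] \<sigma>(2)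
        by (auto simp: algebra_simps)
    qed
    then obtain c where c: "\<And>\<sigma>. \<sigma> \<in> M \<Longrightarrow> card \<sigma> = Suc n \<Longrightarrow>
        c \<sigma> \<in> carrier (chain_group (L \<sigma>) G (int n)) \<and> boundary G (c \<sigma>) = r \<sigma>"
      by metis
    \<comment> \<open>Only simplices with \<open>Suc n\<close> vertices get new values, so the faces
      of any simplex treated so far keep their fillings.\<close>
    let ?\<psi> = "\<lambda>\<sigma>. if card \<sigma> = Suc n then c \<sigma> else \<phi> \<sigma>"
    have "good ?\<psi> \<sigma>" if \<sigma>: "\<sigma> \<in> insert {} M" "card \<sigma> \<le> Suc n" for \<sigma>
    proof -
      have face: "card (\<sigma> - {i}) \<le> n" "good \<phi> (\<sigma> - {i})" if "i \<in> \<sigma>" for i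
      proof -
        show *: "card (\<sigma> - {i}) \<le> n" using that \<sigma>(2) finM(1)[OF \<sigma>(1)] by simp
        show "good \<phi> (\<sigma> - {i})" by (rule \<phi>(2)[OF finM(2)[OF \<sigma>(1)] *]) auto
      qed
      have eq: "comb (\<lambda>i. ?\<psi> (\<sigma> - {i})) (\<lambda>i. pos_sign i \<sigma>) \<sigma> = r \<sigma>"
        unfolding r_def
      proof (rule comb_cong)
        fix i assume i: "i \<in> \<sigma>"
        show "?\<psi> (\<sigma> - {i}) = \<phi> (\<sigma> - {i})" using face(1)[OF i] by auto
        show "\<phi> (\<sigma> - {i}) x \<in> carrier G" for x
          using face(2)[OF i] by (simp add: good_def chain_iff alternating_def)
      qed
      show ?thesis
      proof (cases "card \<sigma> = Suc n")
        case True
        then have "\<sigma> \<in> M" using \<sigma>(1) by auto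
        then show ?thesis using c[of \<sigma>] True eq by (simp add: good_def)
      next
        case False
        then show ?thesis using \<phi>(2)[of \<sigma>] \<sigma> eq by (simp add: good_def r_def)
      qed
    qed
    then show ?case using \<phi>(1) by (intro exI[of _ ?\<psi>]) auto
  qed
  from this[of N] obtain \<phi> where "\<phi> {} = ?e" "\<And>\<sigma>. \<sigma> \<in> insert {} M \<Longrightarrow> good \<phi> \<sigma>"
    using bound by auto
  then show thesis using that[of \<phi>] by (simp add: good_def)
qed

end

section \<open>A top-dimensional cycle whose coefficient has suitable order\<close>

context pseudomfd
begin

text \<open>All nontrivial coefficients of \<open>z\<close> are \<open>z xs0\<close> or its inverse.
  So if \<open>z xs0\<close> squares to \<open>\<one>\<close>, then so does all of \<open>z\<close>,
  and with it the group element \<open>x\<close> that the isomorphism assigns to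
  \<open>z\<close>.\<close>

lemma fundamental_cycle:
  fixes G (structure)
  assumes "comm_group G" "\<not> trivial_group G" "reduced_homology M G (int d) \<cong> G"
  obtains z xs0 where "z \<in> cycles M G (int d)" "z xs0 \<noteq> \<one>"
    "z xs0 \<otimes> z xs0 = \<one> \<longrightarrow> (\<forall>y\<in>carrier G. y \<otimes> y = \<one>)"
proof -
  interpret comm_group G by fact
  have "carrier G \<noteq> {\<one>}" using assms(2) is_group by (simp add: trivial_group_def)
  then have "\<exists>x\<in>carrier G. x \<noteq> \<one>" by auto
  \<comment> \<open>An element with nontrivial square is chosen if there is one; otherwise any
    nontrivial element serves.\<close>
  then obtain x where x: "x \<in> carrier G" "x \<noteq> \<one>" "x \<otimes> x = \<one> \<Longrightarrow> (\<forall>y\<in>carrier G. y \<otimes> y = \<one>)"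
    by (metis r_one)
  obtain z xs0 where z: "z \<in> cycles M G (int d)" "z xs0 \<noteq> \<one>"
    "(\<forall>xs. z xs \<otimes> z xs = \<one>) \<longrightarrow> x \<otimes> x = \<one>"
    using top_homology_iso_cycle[OF assms(3) ordered_simplices_above x(1,2)] by metis
  have ch: "z \<in> carrier (chain_group M G (int d))" using z(1) by (simp add: cycles_iff)
  then have cl: "z xs \<in> carrier G" for xs by (simp add: chain_iff alternating_def)
  show thesis
  proof (rule that[OF z(1,2)], rule impI)
    assume sq: "z xs0 \<otimes> z xs0 = \<one>"
    then have inv: "inv (z xs0) = z xs0" using cl inv_equality by blast
    have "z xs \<otimes> z xs = \<one>" for xs
    proof (cases "z xs = \<one>")
      case False
      then have "xs \<in> ordered_simplices M (int d)" using ch by (auto simp: chain_iff supp_def)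
      then have "z xs \<in> {z xs0, inv (z xs0)}"
        using cycle_values[OF assms(1) z(1,2)] top_simplex_facet by blast
      then show ?thesis using sq inv by simp
    qed simp
    then show "\<forall>y\<in>carrier G. y \<otimes> y = \<one>" using z(3) x(3) by blast
  qed
qed

end

section \<open>Images of the fillings under the colouring\<close>

context comm_group
begin

text \<open>Opposite exponents cancel for every \<open>y\<close>. Equal exponents cancel for
  \<open>a\<close> only if \<open>a\<close> squares to \<open>\<one>\<close>, and then the last
  hypothesis covers \<open>y\<close>. This transfers cancellation at a ridge from \<open>a\<close>
  to the coefficients of a filling.\<close>

lemma opposite_signs:
  assumes "s \<in> {1, - 1 :: int}" "t \<in> {1, - 1 :: int}" "a \<in> carrier G" "y \<in> carrier G"
    and "a [^] s \<otimes> a [^] t = \<one>" "a \<otimes> a = \<one> \<Longrightarrow> y \<otimes> y = \<one>"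
  shows "y [^] s \<otimes> y [^] t = \<one>"
proof (cases "s = t")
  case False
  then have "t = - s" using assms(1,2) by auto
  then show ?thesis using assms(4) by (simp add: int_pow_neg)
next
  case True
  then have sq: "(x \<otimes> x) [^] s = x [^] s \<otimes> x [^] t" if "x \<in> carrier G" for x
    using that by (simp add: int_pow_distrib)
  have "a \<otimes> a = (a [^] s \<otimes> a [^] t) [^] s"
    using assms(1) sq[OF assms(3)] assms(3) by (auto simp: int_pow_pow simp flip: sq)
  then have "y \<otimes> y = \<one>" using assms(5,6) by simp
  then show ?thesis using sq[OF assms(4)] by simp
qed

text \<open>The lists in the support of \<open>\<phi> \<sigma>\<close> have
  \<open>card \<sigma>\<close> entries with colours in \<sigma>, so a nondegenerate image uses every
  colour once. The coefficient follows by induction, computing the image of the boundary at one face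
  in two ways.\<close>

lemma push_filling:
  fixes M :: "'i::linorder set set" and L :: "'i set \<Rightarrow> 'v set set"
  assumes M: "simplicial_complex M" and a: "a \<in> carrier G"
    and col: "\<And>\<sigma> \<tau>. \<sigma> \<in> M \<Longrightarrow> \<tau> \<in> L \<sigma> \<Longrightarrow> col ` \<tau> \<subseteq> \<sigma>"
    and empty: "\<phi> {} = (\<lambda>xs. if xs = [] then a else \<one>)"
    and chain: "\<And>\<sigma>. \<sigma> \<in> insert {} M \<Longrightarrow> \<phi> \<sigma> \<in> carrier (chain_group (L \<sigma>) G (int (card \<sigma>) - 1))"
    and bd: "\<And>\<sigma>. \<sigma> \<in> insert {} M \<Longrightarrow>
       boundary G (\<phi> \<sigma>) = comb (\<lambda>i. \<phi> (\<sigma> - {i})) (\<lambda>i. pos_sign i \<sigma>) \<sigma>"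
    and \<sigma>: "\<sigma> \<in> insert {} M"
  shows "push col (\<phi> \<sigma>) ys \<noteq> \<one> \<Longrightarrow> set ys = \<sigma> \<and> distinct ys"
    and "push col (\<phi> \<sigma>) (sorted_list_of_set \<sigma>) = a"
proof -
  have finM: "finite \<sigma>" "\<And>\<tau>. \<tau> \<subseteq> \<sigma> \<Longrightarrow> \<tau> \<in> insert {} M" if "\<sigma> \<in> insert {} M" for \<sigma>
    using M that by (auto simp: simplicial_complex_def)
  have fs: "fsupp (\<phi> \<sigma>)" if "\<sigma> \<in> insert {} M" for \<sigma>
    using chain_fsupp[OF chain[OF that]] .
  have col': "length xs = card \<sigma>" "distinct xs" "col ` set xs \<subseteq> \<sigma>"
    if "\<sigma> \<in> insert {} M" "\<phi> \<sigma> xs \<noteq> \<one>" for \<sigma> xs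
  proof -
    note s = chain_suppD[OF chain[OF that(1)] that(2)]
    show l: "length xs = card \<sigma>" and "distinct xs" using s by auto
    show "col ` set xs \<subseteq> \<sigma>"
    proof (cases "xs = []")
      case False
      then have "\<sigma> \<noteq> {}" using l by auto
      then show ?thesis using that(1) col[of \<sigma> "set xs"] s(3) False by auto
    qed simp
  qed
  have supp: "set ys = \<sigma> \<and> distinct ys" if \<sigma>: "\<sigma> \<in> insert {} M" and ne: "push col (\<phi> \<sigma>) ys \<noteq> \<one>" for \<sigma> ys
  proof -
    obtain xs where xs: "map col xs = ys" "\<phi> \<sigma> xs \<noteq> \<one>" using push_neq_oneD[OF ne] by blast
    have "distinct ys"
    proof (rule ccontr)
      assume "\<not> distinct ys"
      then have "push col (\<phi> \<sigma>) ys = \<one>"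
        using push_not_distinct[of "\<phi> \<sigma>" ys col] chain[OF \<sigma>] col'(2)[OF \<sigma>] by (simp add: chain_iff)
      then show False using ne by simp
    qed
    moreover have "set ys \<subseteq> \<sigma>" "length ys = card \<sigma>" using xs(1) col'[OF \<sigma> xs(2)] by auto
    ultimately show ?thesis
      using card_subset_eq[OF finM(1)[OF \<sigma>]] by (simp add: distinct_card)
  qed
  show "push col (\<phi> \<sigma>) ys \<noteq> \<one> \<Longrightarrow> set ys = \<sigma> \<and> distinct ys" by (rule supp[OF \<sigma>])
  show "push col (\<phi> \<sigma>) (sorted_list_of_set \<sigma>) = a"
    using \<sigma>
  proof (induction "card \<sigma>" arbitrary: \<sigma>)
    case 0
    then have "\<sigma> = {}" using finM(1)[of \<sigma>] by simp
    moreover have "fprod (\<phi> {}) {xs. map col xs = []} = finprod G (\<phi> {}) {[]}"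
      by (rule fprod_eq_finprod[OF fs]) auto
    ultimately show ?case
      using a by (simp add: push_def empty)
  next
    case (Suc n)
    have fin: "finite \<sigma>" using finM(1) Suc.prems by blast
    have ne: "\<sigma> \<noteq> {}" using Suc.hyps(2) by auto
    \<comment> \<open>The face opposite the smallest vertex avoids signs: prepending that vertex
      yields the sorted list, and its incidence number is \<open>1\<close>.\<close>
    let ?i = "Min \<sigma>" and ?ws = "sorted_list_of_set (\<sigma> - {Min \<sigma>})"
    have iin: "?i \<in> \<sigma>" using fin ne by simp
    have face: "\<sigma> - {i} \<in> insert {} M" for i
      by (rule finM(2)[OF Suc.prems]) auto
    have "push col (boundary G (\<phi> \<sigma>)) ?ws = (\<Otimes>u\<in>\<sigma>. push col (\<phi> \<sigma>) (u # ?ws))"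
      by (rule push_boundary[OF fs[OF Suc.prems] fin]) (use col'[OF Suc.prems] in auto)
    also have "\<dots> = push col (\<phi> \<sigma>) (?i # ?ws)"
    proof (rule finprod_delta[OF fin iin push_closed[OF fs[OF Suc.prems]]])
      fix u assume "u \<in> \<sigma>" "u \<noteq> ?i"
      then have "\<not> distinct (u # ?ws)" using fin by simp
      then show "push col (\<phi> \<sigma>) (u # ?ws) = \<one>" using supp[OF Suc.prems] by blast
    qed
    also have "?i # ?ws = sorted_list_of_set \<sigma>"
      using fin ne by (simp add: sorted_list_of_set_nonempty)
    finally have 1: "push col (\<phi> \<sigma>) (sorted_list_of_set \<sigma>) = push col (boundary G (\<phi> \<sigma>)) ?ws" ..
    have "push col (boundary G (\<phi> \<sigma>)) ?ws
        = (\<Otimes>i\<in>\<sigma>. push col (\<phi> (\<sigma> - {i})) ?ws [^] pos_sign i \<sigma>)"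
      unfolding bd[OF Suc.prems]
      by (subst push_comb) (use fin fs[OF face] in \<open>auto simp: comb_def\<close>)
    also have "\<dots> = push col (\<phi> (\<sigma> - {?i})) ?ws [^] pos_sign ?i \<sigma>"
    proof (rule finprod_delta[OF fin iin])
      show "push col (\<phi> (\<sigma> - {?i})) ?ws [^] pos_sign ?i \<sigma> \<in> carrier G"
        by (intro int_pow_closed push_closed fs face)
      fix i assume "i \<in> \<sigma>" "i \<noteq> ?i"
      then have "set ?ws \<noteq> \<sigma> - {i}" using fin iin by auto
      then have "push col (\<phi> (\<sigma> - {i})) ?ws = \<one>" using supp[OF face] by blast
      then show "push col (\<phi> (\<sigma> - {i})) ?ws [^] pos_sign i \<sigma> = \<one>" by simp
    qed
    also have "push col (\<phi> (\<sigma> - {?i})) ?ws = a"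
      using Suc.hyps(1)[OF _ face[of ?i]] Suc.hyps(2) fin iin by simp
    also have "pos_sign ?i \<sigma> = 1"
    proof -
      have "{j \<in> \<sigma>. j < ?i} = {}" using fin by (auto simp flip: not_le)
      then show ?thesis by (simp only: pos_sign_def card.empty power_0)
    qed
    finally show ?case using 1 a by simp
  qed
qed

end

section \<open>Gluing the fillings along ridges, and the size of a filling of the cycle\<close>

context pseudomfd
begin

text \<open>Expanding all boundaries gives one factor for each pair of a facet and a vertex in it.
  Regrouped by the ridge left after removing the vertex, two factors remain per ridge, both powers
  of the same \<open>\<phi> \<rho> ws\<close>. The cycle condition on \<open>z\<close> gives their
  cancellation for \<open>a\<close>, and \<open>opposite_signs\<close> transfers it.\<close>

lemma filling_cycle:
  fixes G (structure) and \<phi> :: "nat set \<Rightarrow> 'v list \<Rightarrow> 'a"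
  assumes "comm_group G" and z: "z \<in> cycles M G (int d)"
    and a: "a \<in> carrier G" "a \<otimes> a = \<one> \<Longrightarrow> (\<forall>y\<in>carrier G. y \<otimes> y = \<one>)"
    and eps: "\<And>\<sigma>. facet M \<sigma> \<Longrightarrow> \<epsilon> \<sigma> \<in> {1, - 1}"
      "\<And>\<sigma>. facet M \<sigma> \<Longrightarrow> z (sorted_list_of_set \<sigma>) = a [^] \<epsilon> \<sigma>"
    and fs: "\<And>\<sigma>. \<sigma> \<in> insert {} M \<Longrightarrow> comm_group.fsupp G (\<phi> \<sigma>)"
    and bd: "\<And>\<sigma>. \<sigma> \<in> M \<Longrightarrow> boundary G (\<phi> \<sigma>) =
       comm_group.comb G (\<lambda>i. \<phi> (\<sigma> - {i})) (\<lambda>i. pos_sign i \<sigma>) \<sigma>"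
  shows "boundary G (comm_group.comb G \<phi> \<epsilon> {\<sigma>. facet M \<sigma>}) ws = \<one>"
proof -
  interpret comm_group G by fact
  let ?F = "{\<sigma>. facet M \<sigma>}"
  have finF: "finite ?F" using finite_complex by (rule finite_subset[rotated]) (auto simp: facet_def)
  have fin: "finite \<sigma>" if "\<sigma> \<in> ?F" for \<sigma> using that facetD simplexD(1) by blast
  have face: "\<sigma> - {i} \<in> insert {} M" if "\<sigma> \<in> ?F" for \<sigma> i
    using simplexD(3)[of \<sigma> "\<sigma> - {i}"] that facetD by blast
  have cl: "\<phi> (\<sigma> - {i}) ws \<in> carrier G" if "\<sigma> \<in> ?F" for \<sigma> i
    using fs[OF face[OF that]] by (simp add: fsupp_def)
  define h where "h x = (if x \<in> Sigma ?F id
      then \<phi> (fst x - {snd x}) ws [^] (pos_sign (snd x) (fst x) * \<epsilon> (fst x)) else \<one>)" for x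
  let ?R = "(\<lambda>x. fst x - {snd x}) ` Sigma ?F id"
  have finS: "finite (Sigma ?F id)" using finF fin by auto
  have hsupp: "supp h \<subseteq> Sigma ?F id" by (auto simp: supp_def h_def split: if_splits)
  have hfs: "fsupp h"
    using cl finite_subset[OF hsupp finS] by (auto simp: fsupp_def h_def)
  have hcl: "h x \<in> carrier G" for x using hfs unfolding fsupp_def by blast
  have "boundary G (comb \<phi> \<epsilon> ?F) ws = (\<Otimes>\<sigma>\<in>?F. boundary G (\<phi> \<sigma>) ws [^] \<epsilon> \<sigma>)"
    using boundary_comb[OF finF, of \<phi> \<epsilon>] fs facetD by (simp add: comb_def)
  also have "\<dots> = (\<Otimes>\<sigma>\<in>?F. fprod h {x \<in> UNIV. fst x = \<sigma>})"
  proof (rule finprod_cong'[OF refl])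
    fix \<sigma> assume \<sigma>: "\<sigma> \<in> ?F"
    have "boundary G (\<phi> \<sigma>) ws [^] \<epsilon> \<sigma> = (\<Otimes>i\<in>\<sigma>. (\<phi> (\<sigma> - {i}) ws [^] pos_sign i \<sigma>) [^] \<epsilon> \<sigma>)"
      using bd[of \<sigma>] \<sigma> facetD cl by (simp add: comb_def finprod_int_pow)
    also have "\<dots> = (\<Otimes>i\<in>\<sigma>. h (\<sigma>, i))"
      by (rule finprod_cong') (use \<sigma> hcl cl in \<open>auto simp: h_def int_pow_pow\<close>)
    also have "\<dots> = finprod G h (Pair \<sigma> ` \<sigma>)"
      by (rule finprod_reindex[symmetric]) (use hcl in \<open>auto simp: inj_on_def\<close>)
    also have "\<dots> = fprod h {x \<in> UNIV. fst x = \<sigma>}"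
      by (rule fprod_eq_finprod[symmetric, OF hfs]) (use fin[OF \<sigma>] hsupp in auto)
    finally show "boundary G (\<phi> \<sigma>) ws [^] \<epsilon> \<sigma> = fprod h {x \<in> UNIV. fst x = \<sigma>}" .
  qed (auto intro: fprod_closed[OF hfs])
  also have "\<dots> = fprod h UNIV"
    by (rule fprod_partition[symmetric, OF hfs finF]) (use hsupp in auto)
  also have "\<dots> = (\<Otimes>\<rho>\<in>?R. fprod h {x \<in> UNIV. fst x - {snd x} = \<rho>})"
    by (rule fprod_partition[OF hfs]) (use finS hsupp in auto)
  also have "\<dots> = \<one>"
  proof (rule finprod_one_eqI)
    fix \<rho> assume "\<rho> \<in> ?R"
    then obtain \<sigma> i where \<sigma>i: "facet M \<sigma>" "i \<in> \<sigma>" "\<rho> = \<sigma> - {i}" by auto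
    then have "ridge M \<rho>" using ridge_remove by simp
    then obtain u v where uv: "u \<noteq> v" "u \<notin> \<rho>" "v \<notin> \<rho>" "finite \<rho>"
      "{\<tau>. facet M \<tau> \<and> \<rho> \<subseteq> \<tau>} = {insert u \<rho>, insert v \<rho>}"
      by (rule ridge_facets)
    have f: "facet M (insert u \<rho>)" "facet M (insert v \<rho>)" using uv(5) by blast+
    have y: "\<phi> \<rho> ws \<in> carrier G" using cl \<sigma>i by auto
    \<comment> \<open>Incidence number times orientation: the exponent with which
      \<open>\<phi> \<rho>\<close> enters from the facet \<open>insert x \<rho>\<close>, and also
      the exponent of \<open>a\<close> in the coefficient of \<open>z\<close> there.\<close>
    let ?e = "\<lambda>x. pos_sign x (insert x \<rho>) * \<epsilon> (insert x \<rho>)"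
    have sgn: "?e x \<in> {1, - 1}" if "facet M (insert x \<rho>)" for x
      using eps(1)[OF that] pos_sign_cases[of x "insert x \<rho>"] by auto
    have alt: "alternating z" using z by (simp add: cycles_iff chain_iff)
    have zx: "z (x # sorted_list_of_set \<rho>) = a [^] ?e x" if "x \<notin> \<rho>" "facet M (insert x \<rho>)" for x
      using alternating_Cons_sorted[OF alt uv(4) that(1)] eps(2)[OF that(2)] a(1)
      by (simp add: int_pow_pow mult.commute)
    have "z (u # sorted_list_of_set \<rho>) \<otimes> z (v # sorted_list_of_set \<rho>) = \<one>"
      by (rule cycle_at_ridge[OF assms(1) z]) (use uv in auto)
    then have "a [^] ?e u \<otimes> a [^] ?e v = \<one>" using zx uv f by simp
    then have cancel: "\<phi> \<rho> ws [^] ?e u \<otimes> \<phi> \<rho> ws [^] ?e v = \<one>"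
      using opposite_signs[OF sgn[OF f(1)] sgn[OF f(2)] a(1) y] a(2) y by blast
    have "fprod h {x \<in> UNIV. fst x - {snd x} = \<rho>} = finprod G h {(insert u \<rho>, u), (insert v \<rho>, v)}"
    proof (rule fprod_eq_finprod[OF hfs])
      show "{x \<in> UNIV. fst x - {snd x} = \<rho>} \<inter> supp h \<subseteq> {(insert u \<rho>, u), (insert v \<rho>, v)}"
      proof
        fix x assume "x \<in> {x \<in> UNIV. fst x - {snd x} = \<rho>} \<inter> supp h"
        then obtain \<tau> j where x: "x = (\<tau>, j)" "facet M \<tau>" "j \<in> \<tau>" "\<tau> - {j} = \<rho>"
          using hsupp by (cases x) auto
        then have "\<tau> \<in> {\<tau>. facet M \<tau> \<and> \<rho> \<subseteq> \<tau>}" by auto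
        then have "\<tau> = insert u \<rho> \<or> \<tau> = insert v \<rho>" unfolding uv(5) by simp
        moreover have "\<tau> = insert j \<rho>" "j \<notin> \<rho>" using x by auto
        ultimately show "x \<in> {(insert u \<rho>, u), (insert v \<rho>, v)}"
          using x(1) by (metis insertCI insertE)
      qed
    qed (use uv in auto)
    also have "\<dots> = h (insert u \<rho>, u) \<otimes> h (insert v \<rho>, v)"
      using uv(1) hcl by simp
    also have "\<dots> = \<phi> \<rho> ws [^] ?e u \<otimes> \<phi> \<rho> ws [^] ?e v"
      using f uv(2,3) by (simp add: h_def)
    finally show "fprod h {x \<in> UNIV. fst x - {snd x} = \<rho>} = \<one>" using cancel by simp
  qed
  finally show ?thesis .
qed

text \<open>A maximal connected piece \<open>S\<close> of the support of a chain bounded by the cycle has a boundary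
  that is again a nonzero cycle on the pseudomanifold, hence meets every facet. Adding the simplices
  of \<open>S\<close> one at a time, each contributes at most one new vertex.\<close>

lemma card_vertices_le_filling:
  fixes G (structure) and b :: "nat list \<Rightarrow> 'a"
  assumes "comm_group G" and z: "z \<in> cycles M G (int d)" "z xs0 \<noteq> \<one>"
    and b: "comm_group.alternating G b" "finite (comm_group.supp G b)"
    and bsupp: "\<And>ys. b ys \<noteq> \<one> \<Longrightarrow> distinct ys \<and> length ys = d + 2 \<and> set ys \<subseteq> U"
    and U: "finite U" and zb: "\<And>ws. z ws = (\<Otimes>v\<in>U. b (v # ws))"
  shows "card (vertices M) \<le> card (set ` comm_group.supp G b) + d + 1"
proof -
  interpret comm_group G by fact
  let ?T = "set ` supp b"
  have finT: "finite ?T" using b(2) by simp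
  have T: "finite \<tau>" "card \<tau> = d + 2" if "\<tau> \<in> ?T" for \<tau>
    using that bsupp by (auto simp: supp_def distinct_card)
  have bcl: "b ys \<in> carrier G" for ys using b(1) by (simp add: alternating_def)
  have ch: "z \<in> carrier (chain_group M G (int d))" using z(1) by (simp add: cycles_iff)
  have alt: "alternating z" using ch by (simp add: chain_iff)
  have "\<exists>v\<in>U. b (v # xs0) \<noteq> \<one>"
    using finprod_one_eqI[of U "\<lambda>v. b (v # xs0)"] z(2) zb by force
  then obtain v0 where v0: "b (v0 # xs0) \<noteq> \<one>" by blast
  define \<tau>0 where "\<tau>0 = set (v0 # xs0)"
  have \<tau>0: "\<tau>0 \<in> ?T" "set xs0 \<subseteq> \<tau>0"
    unfolding \<tau>0_def using v0 by (intro imageI) (auto simp: supp_def)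
  \<comment> \<open>In place of connectivity only its consequence is recorded, a bound on the number
    of vertices covered. It holds for \<open>{\<tau>0}\<close>, since
    \<open>d + 2 = 1 + d + 1\<close>.\<close>
  let ?X = "{S. S \<subseteq> ?T \<and> \<tau>0 \<in> S \<and> card (\<Union>S) \<le> card S + d + 1}"
  have "finite ?X" by (rule finite_subset[of _ "Pow ?T"]) (use finT in auto)
  moreover have "{\<tau>0} \<in> ?X" using \<tau>0(1) T(2)[OF \<tau>0(1)] by simp
  ultimately have "\<exists>S\<in>?X. \<forall>S'\<in>?X. S \<subseteq> S' \<longrightarrow> S = S'"
    by (intro finite_has_maximal) auto
  then obtain S where S: "S \<in> ?X" and max: "\<And>S'. S' \<in> ?X \<Longrightarrow> S \<subseteq> S' \<Longrightarrow> S = S'"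
    by (elim bexE) simp
  have finS: "finite S" using S finT finite_subset by blast
  have finUS: "finite (\<Union>S)" using finS S T(1) by blast
  \<comment> \<open>A simplex sharing \<open>d + 1\<close> vertices with a member of
    \<open>S\<close> adds at most one vertex, so adjoining it would keep the bound and contradict
    maximality.\<close>
  have closed: "\<tau> \<in> S" if \<tau>: "\<tau> \<in> ?T" "\<tau>' \<in> S" "\<rho> \<subseteq> \<tau>" "\<rho> \<subseteq> \<tau>'" "card \<rho> = d + 1" for \<tau> \<tau>' \<rho>
  proof (rule ccontr)
    assume n: "\<tau> \<notin> S"
    have fin\<rho>: "finite \<rho>" using \<tau>(1,3) T(1) finite_subset by blast
    have "card (\<tau> - \<rho>) = 1" using T[OF \<tau>(1)] \<tau>(3,5) fin\<rho> by (simp add: card_Diff_subset)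
    have "\<Union>(insert \<tau> S) \<subseteq> \<Union>S \<union> (\<tau> - \<rho>)" using \<tau>(2,4) by blast
    then have "card (\<Union>(insert \<tau> S)) \<le> card (\<Union>S \<union> (\<tau> - \<rho>))"
      by (rule card_mono[rotated]) (use finUS T(1)[OF \<tau>(1)] in simp)
    also have "\<dots> \<le> card (\<Union>S) + 1" using card_Un_le[of "\<Union>S" "\<tau> - \<rho>"] \<open>card (\<tau> - \<rho>) = 1\<close> by simp
    also have "\<dots> \<le> card (insert \<tau> S) + d + 1" using S n finS by simp
    finally have "insert \<tau> S \<in> ?X" using S \<tau>(1) by simp
    then have "S = insert \<tau> S" using max by blast
    then show False using n by blast
  qed
  \<comment> \<open>\<open>bS\<close> is the part of \<open>b\<close> on \<open>S\<close>, and
    \<open>w\<close> will be its boundary. If \<open>ws\<close> lies in a member of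
    \<open>S\<close>, then by \<open>closed\<close> all simplices of the support that extend
    \<open>ws\<close> by one vertex are in \<open>S\<close>, so \<open>z\<close> is unchanged there;
    at other \<open>ws\<close> no factor remains.\<close>
  define w where "w ws = (if \<exists>\<tau>\<in>S. set ws \<subseteq> \<tau> then z ws else \<one>)" for ws
  define bS where "bS ys = (if set ys \<in> S then b ys else \<one>)" for ys
  have bScl: "bS ys \<in> carrier G" for ys using bcl by (simp add: bS_def)
  have w: "w ws = (\<Otimes>v\<in>U. bS (v # ws))" for ws
  proof (cases "\<exists>\<tau>\<in>S. set ws \<subseteq> \<tau>")
    case True
    then obtain \<tau> where \<tau>: "\<tau> \<in> S" "set ws \<subseteq> \<tau>" by blast
    have "b (v # ws) = bS (v # ws)" for v
    proof (cases "b (v # ws) = \<one>")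
      case False
      have "set (v # ws) \<in> ?T" by (rule imageI) (simp add: supp_def False)
      moreover have "distinct ws" "length ws = d + 1" using bsupp[OF False] by auto
      ultimately have "set (v # ws) \<in> S"
        using closed[of "set (v # ws)" \<tau> "set ws"] \<tau> by (auto simp: distinct_card)
      then show ?thesis by (simp add: bS_def)
    qed (simp add: bS_def)
    then show ?thesis using True by (simp add: w_def zb)
  next
    case False
    then have "bS (v # ws) = \<one>" for v by (auto simp: bS_def)
    then show ?thesis using False by (auto simp: w_def)
  qed
  have "w \<in> cycles M G (int d)"
    unfolding cycles_iff
  proof (intro conjI allI)
    have "alternating w"
      using alt by (auto simp: alternating_def w_def)
    moreover have "supp w \<subseteq> supp z" by (auto simp: supp_def w_def split: if_splits)
    ultimately show "w \<in> carrier (chain_group M G (int d))"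
      using ch finite_subset by (auto simp: chain_iff)
    then have wcl: "w ws \<in> carrier G" for ws by (simp add: chain_iff alternating_def)
    fix us
    have inU: "v \<in> U \<and> v' \<in> U \<and> v \<noteq> v'" if "bS (v' # v # us) \<noteq> \<one>" for v v'
      using that bsupp[of "v' # v # us"] by (auto simp: bS_def split: if_splits)
    have "boundary G w us = (\<Otimes>u\<in>U. w (u # us))"
      unfolding boundary_def
    proof (rule finprod_mono_neutral_cong_left[OF U])
      show "{v. w (v # us) \<noteq> \<one>} \<subseteq> U"
      proof
        fix v assume "v \<in> {v. w (v # us) \<noteq> \<one>}"
        then obtain v' where "bS (v' # v # us) \<noteq> \<one>"
          using finprod_one_eqI[of U "\<lambda>v'. bS (v' # v # us)"] w[of "v # us"] by auto
        then show "v \<in> U" using inU by blast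
      qed
    qed (use wcl in auto)
    also have "\<dots> = (\<Otimes>u\<in>U. \<Otimes>v\<in>U. bS (v # u # us))" by (simp add: w)
    also have "\<dots> = \<one>"
    proof (rule finprod_antisymmetric[OF U])
      fix u v
      show "bS (v # u # us) \<in> carrier G" by (rule bScl)
      show "bS (u # u # us) = \<one>" using inU by blast
      show "bS (u # v # us) = inv (bS (v # u # us))"
        using alternating_swap[OF b(1), of "[]" u v us] by (simp add: bS_def insert_commute)
    qed
    finally show "boundary G w us = \<one>" .
  qed
  moreover have wx: "w xs0 \<noteq> \<one>" using S \<tau>0(2) z(2) by (auto simp: w_def)
  ultimately have vals: "w xs \<in> {w xs0, inv (w xs0)}" if "distinct xs" "facet M (set xs)" for xs
    using cycle_values[OF assms(1)] that by blast
  have wcl: "w ws \<in> carrier G" for ws using alt by (simp add: w_def alternating_def)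
  \<comment> \<open>The cycle \<open>w\<close> is nontrivial at \<open>xs0\<close>, hence on every
    facet, while it is trivial outside the members of \<open>S\<close>.\<close>
  have "\<sigma> \<subseteq> \<Union>S" if \<sigma>: "facet M \<sigma>" for \<sigma>
  proof -
    have fin: "finite \<sigma>" using \<sigma> facetD simplexD(1) by blast
    then have "w (sorted_list_of_set \<sigma>) \<noteq> \<one>"
      using vals[of "sorted_list_of_set \<sigma>"] \<sigma> wx wcl by auto
    then show ?thesis using fin by (auto simp: w_def split: if_splits)
  qed
  then have "vertices M \<subseteq> \<Union>S" unfolding vertices_def by (meson Union_least in_facet order_trans)
  then have "card (vertices M) \<le> card (\<Union>S)" by (rule card_mono[OF finUS])
  also have "\<dots> \<le> card S + d + 1" using S by simp
  also have "\<dots> \<le> card ?T + d + 1" using card_mono[OF finT] S by simp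
  finally show ?thesis .
qed

end

section \<open>Counting colourful simplices\<close>

lemma induced_subcomplex_mono: "U \<subseteq> W \<Longrightarrow> induced_subcomplex K U \<subseteq> induced_subcomplex K W"
  by (auto simp: induced_subcomplex_def)

text \<open>\<open>card\<close> is \<open>0\<close> on infinite sets, hence the first alternative.
  Truncated subtraction in \<open>m - d\<close> is harmless, because a facet of \<open>M\<close> has
  \<open>d + 1\<close> vertices among \<open>{0..m}\<close>.\<close>

theorem theorem2:
  fixes K :: "'v set set" and V :: "nat \<Rightarrow> 'v set" and m :: nat
    and A :: "('a, 'b) monoid_scheme"
    and M :: "nat set set" and d :: nat
  assumes "simplicial_complex K"
    and "vertices K = (\<Union>i\<le>m. V i)" and "disjoint_family_on V {..m}"
    and "comm_group A" and "\<not> trivial_group A"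
    and "pseudomanifold d M" and "vertices M = {0..m}"
    and "reduced_homology M A (int d) \<cong> A"
    and "\<And>\<sigma>. \<sigma> \<in> M \<Longrightarrow>
           trivial_group
             (reduced_homology (induced_subcomplex K (\<Union>i\<in>\<sigma>. V i)) A (int (card \<sigma>) - 2))"
    and "trivial_group (reduced_homology K A (int d))"
  shows "infinite (colourful_simplices K m V (d + 1)) \<or>
         card (colourful_simplices K m V (d + 1)) \<ge> m - d"
proof -
  interpret A: comm_group A by fact
  interpret M: pseudomfd d M
    using assms(6,7) by unfold_locales auto
  define L where "L \<sigma> = induced_subcomplex K (\<Union>i\<in>\<sigma>. V i)" for \<sigma>
  let ?F = "{\<sigma>. facet M \<sigma>}"
  have complexM: "simplicial_complex M" using assms(6) by (simp add: pseudomanifold_def)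
  have finF: "finite ?F"
    using M.finite_complex by (rule finite_subset[rotated]) (auto simp: facet_def)
  have finM: "finite \<sigma>" if "facet M \<sigma>" for \<sigma> using M.simplexD(1) M.facetD that by blast

  obtain z xs0 where z: "z \<in> cycles M A (int d)" "z xs0 \<noteq> \<one>\<^bsub>A\<^esub>"
    "z xs0 \<otimes>\<^bsub>A\<^esub> z xs0 = \<one>\<^bsub>A\<^esub> \<longrightarrow> (\<forall>y\<in>carrier A. y \<otimes>\<^bsub>A\<^esub> y = \<one>\<^bsub>A\<^esub>)"
    by (rule M.fundamental_cycle[OF assms(4,5,8)])
  let ?a = "z xs0"
  have zch: "z \<in> carrier (chain_group M A (int d))" using z(1) by (simp add: A.cycles_iff)
  then have zalt: "A.alternating z" by (simp add: A.chain_iff)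
  then have a: "?a \<in> carrier A" by (simp add: A.alternating_def)
  \<comment> \<open>The sign of a facet relative to \<open>?a\<close>. If \<open>?a\<close> is its
    own inverse, both signs fit and \<open>1\<close> is taken where \<open>z\<close> equals
    \<open>?a\<close>.\<close>
  define \<epsilon> :: "nat set \<Rightarrow> int" where "\<epsilon> \<sigma> = (if z (sorted_list_of_set \<sigma>) = ?a then 1 else - 1)" for \<sigma>
  have eps: "\<epsilon> \<sigma> \<in> {1, - 1}" for \<sigma> by (simp add: \<epsilon>_def)
  have z_eps: "z (sorted_list_of_set \<sigma>) = ?a [^]\<^bsub>A\<^esub> \<epsilon> \<sigma>" if "facet M \<sigma>" for \<sigma>
    using M.cycle_values[OF assms(4) z(1,2), of "sorted_list_of_set \<sigma>"] that finM[OF that] a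
    by (auto simp: \<epsilon>_def A.int_pow_neg)

  obtain \<phi> where empty: "\<phi> {} = (\<lambda>xs. if xs = [] then ?a else \<one>\<^bsub>A\<^esub>)"
    and chain: "\<And>\<sigma>. \<sigma> \<in> insert {} M \<Longrightarrow>
       \<phi> \<sigma> \<in> carrier (chain_group (L \<sigma>) A (int (card \<sigma>) - 1))"
    and bd: "\<And>\<sigma>. \<sigma> \<in> insert {} M \<Longrightarrow>
       boundary A (\<phi> \<sigma>) = A.comb (\<lambda>i. \<phi> (\<sigma> - {i})) (\<lambda>i. pos_sign i \<sigma>) \<sigma>"
  proof (rule A.acyclic_carrier_chains[OF complexM a, of L "d + 1"])
    show "trivial_group (reduced_homology (L \<sigma>) A (int (card \<sigma>) - 2))" if "\<sigma> \<in> M" for \<sigma>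
      using assms(9)[OF that] by (simp add: L_def)
    show "L \<tau> \<subseteq> L \<sigma>" if "\<tau> \<subseteq> \<sigma>" for \<tau> \<sigma>
      unfolding L_def by (rule induced_subcomplex_mono) (use that in blast)
  qed (use M.card_simplex in blast)+

  \<comment> \<open>The coefficient \<open>?a\<close> is already built into the fillings through
    \<open>empty\<close>, so the facets enter with their signs only.\<close>
  define \<zeta> where "\<zeta> = A.comb \<phi> \<epsilon> ?F"
  have chainF: "\<phi> \<sigma> \<in> carrier (chain_group K A (int d))" if "\<sigma> \<in> ?F" for \<sigma>
  proof (rule A.chain_mono)
    show "L \<sigma> \<subseteq> K" by (auto simp: L_def induced_subcomplex_def)
    show "\<phi> \<sigma> \<in> carrier (chain_group (L \<sigma>) A (int d))"
      using chain[of \<sigma>] that M.facet_card[of \<sigma>] M.facetD[of \<sigma>] by simp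
  qed
  have fs: "A.fsupp (\<phi> \<sigma>)" if "\<sigma> \<in> insert {} M" for \<sigma>
    by (rule A.chain_fsupp[OF chain[OF that]])
  have \<zeta>ch: "\<zeta> \<in> carrier (chain_group K A (int d))"
    unfolding \<zeta>_def by (rule A.chain_comb[OF finF chainF])
  moreover have "boundary A \<zeta> ws = \<one>\<^bsub>A\<^esub>" for ws
    unfolding \<zeta>_def
    by (rule M.filling_cycle[OF assms(4) z(1) a z(3)[THEN mp] eps z_eps fs bd]) auto
  ultimately have "\<zeta> \<in> cycles K A (int d)" by (simp add: A.cycles_iff)
  then obtain c where c: "c \<in> carrier (chain_group K A (int d + 1))" "boundary A c = \<zeta>"
    by (rule A.trivial_homology_cycleD[OF assms(10)])

  \<comment> \<open>On vertices of \<open>K\<close> this is the colour, unique because the classes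
    are disjoint; elsewhere the value may be arbitrary.\<close>
  define col where "col v = (SOME i. i \<le> m \<and> v \<in> V i)" for v
  have col_eq: "col v = i" if "i \<le> m" "v \<in> V i" for v i
  proof -
    have "col v \<le> m \<and> v \<in> V (col v)" unfolding col_def by (rule someI) (use that in blast)
    then show ?thesis using assms(3) that by (auto simp: disjoint_family_on_def)
  qed
  have colK: "col v \<le> m" "v \<in> V (col v)" if "\<tau> \<in> K" "v \<in> \<tau>" for v \<tau>
  proof -
    have "v \<in> (\<Union>i\<le>m. V i)" using that assms(2) by (auto simp: vertices_def)
    then show "col v \<le> m" "v \<in> V (col v)" using col_eq by auto
  qed
  have M_le: "i \<le> m" if "\<sigma> \<in> M" "i \<in> \<sigma>" for \<sigma> i
    using assms(7) that by (auto simp: vertices_def)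
  have colL: "col ` \<tau> \<subseteq> \<sigma>" if "\<sigma> \<in> M" "\<tau> \<in> L \<sigma>" for \<sigma> \<tau>
    using that col_eq M_le by (fastforce simp: L_def induced_subcomplex_def)
  note push_\<phi> = A.push_filling[where L = L and col = col, OF complexM a colL empty chain bd]

  define b where "b = A.push col c"
  have cfs: "A.fsupp c" by (rule A.chain_fsupp[OF c(1)])
  have calt: "A.alternating c" "finite (A.supp c)" using c(1) by (auto simp: A.chain_iff)
  have cD: "distinct xs" "length xs = d + 2" "set xs \<in> K" if "c xs \<noteq> \<one>\<^bsub>A\<^esub>" for xs
    using A.chain_suppD[OF c(1) that] by auto
  have bD: "\<exists>xs. map col xs = ys \<and> c xs \<noteq> \<one>\<^bsub>A\<^esub> \<and> distinct ys" if "b ys \<noteq> \<one>\<^bsub>A\<^esub>" for ys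
    using A.push_neq_oneD[of col c ys] A.push_not_distinct[OF calt cD(1), of ys col] that
    unfolding b_def by blast
  \<comment> \<open>At the sorted list of a facet only the filling of that facet has a nontrivial
    image, with coefficient \<open>?a\<close>, and the sign restores \<open>z\<close>. At the sorted
    list of any other finite set both sides are trivial.\<close>
  have zb: "z = A.push col \<zeta>"
  proof (rule A.alternating_ext[OF zalt])
    show "A.alternating (A.push col \<zeta>)"
      by (rule A.push_alternating) (use \<zeta>ch in \<open>auto simp: A.chain_iff\<close>)
    show "z xs = A.push col \<zeta> xs" if "\<not> distinct xs" for xs
    proof -
      have "z xs = \<one>\<^bsub>A\<^esub>" using A.chain_suppD(1)[OF zch] that by blast
      moreover have "A.push col \<zeta> xs = \<one>\<^bsub>A\<^esub>"
        by (rule A.push_not_distinct)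
          (use that \<zeta>ch A.chain_suppD(1)[OF \<zeta>ch] in \<open>auto simp: A.chain_iff\<close>)
      ultimately show ?thesis by simp
    qed
    fix \<sigma> :: "nat set" assume fin: "finite \<sigma>"
    let ?s = "sorted_list_of_set \<sigma>"
    have "A.push col \<zeta> ?s = (\<Otimes>\<^bsub>A\<^esub>\<tau>\<in>?F. A.push col (\<phi> \<tau>) ?s [^]\<^bsub>A\<^esub> \<epsilon> \<tau>)"
      unfolding \<zeta>_def
      by (subst A.push_comb[OF finF A.chain_fsupp[OF chainF]]) (auto simp: A.comb_def)
    also have "\<dots> = z ?s"
    proof (cases "facet M \<sigma>")
      case True
      have "(\<Otimes>\<^bsub>A\<^esub>\<tau>\<in>?F. A.push col (\<phi> \<tau>) ?s [^]\<^bsub>A\<^esub> \<epsilon> \<tau>) = A.push col (\<phi> \<sigma>) ?s [^]\<^bsub>A\<^esub> \<epsilon> \<sigma>"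
      proof (rule A.finprod_delta[OF finF])
        show "A.push col (\<phi> \<sigma>) ?s [^]\<^bsub>A\<^esub> \<epsilon> \<sigma> \<in> carrier A"
          by (intro A.int_pow_closed A.push_closed A.chain_fsupp[OF chainF]) (use True in simp)
        fix \<tau> assume "\<tau> \<in> ?F" "\<tau> \<noteq> \<sigma>"
        then have "A.push col (\<phi> \<tau>) ?s = \<one>\<^bsub>A\<^esub>"
          using push_\<phi>(1)[of \<tau> ?s] fin M.facetD[of \<tau>] by auto
        then show "A.push col (\<phi> \<tau>) ?s [^]\<^bsub>A\<^esub> \<epsilon> \<tau> = \<one>\<^bsub>A\<^esub>" by simp
      qed (use True in simp)
      then show ?thesis
        using push_\<phi>(2)[of \<sigma>] M.facetD[OF True] z_eps[OF True] by simp
    next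
      case False
      have "A.push col (\<phi> \<tau>) ?s = \<one>\<^bsub>A\<^esub>" if "\<tau> \<in> ?F" for \<tau>
        using push_\<phi>(1)[of \<tau> ?s] fin M.facetD[of \<tau>] that False by auto
      then have "(\<Otimes>\<^bsub>A\<^esub>\<tau>\<in>?F. A.push col (\<phi> \<tau>) ?s [^]\<^bsub>A\<^esub> \<epsilon> \<tau>) = \<one>\<^bsub>A\<^esub>"
        by (intro A.finprod_one_eqI) simp
      moreover have "z ?s = \<one>\<^bsub>A\<^esub>"
      proof (rule ccontr)
        assume "z ?s \<noteq> \<one>\<^bsub>A\<^esub>"
        then have "?s \<in> ordered_simplices M (int d)" using zch by (auto simp: A.chain_iff A.supp_def)
        then show False using M.top_simplex_facet(1) False fin by fastforce
      qed
      ultimately show ?thesis by simp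
    qed
    finally show "z ?s = A.push col \<zeta> ?s" by simp
  qed

  have "card (vertices M) \<le> card (set ` A.supp b) + d + 1"
  proof (rule M.card_vertices_le_filling[OF assms(4) z(1,2)])
    show "A.alternating b" unfolding b_def by (rule A.push_alternating[OF calt])
    have "A.supp b \<subseteq> map col ` A.supp c" using bD by (fastforce simp: A.supp_def)
    then show "finite (A.supp b)" using calt(2) finite_surj by blast
    show "distinct ys \<and> length ys = d + 2 \<and> set ys \<subseteq> {0..m}" if "b ys \<noteq> \<one>\<^bsub>A\<^esub>" for ys
      using bD[OF that] cD colK(1) by fastforce
    show "z ws = (\<Otimes>\<^bsub>A\<^esub>v\<in>{0..m}. b (v # ws))" for ws
      unfolding zb b_def c(2)[symmetric]
      by (rule A.push_boundary[OF cfs]) (auto intro: colK(1)[OF cD(3)])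
  qed simp
  \<comment> \<open>A list in the support of \<open>b\<close> has no repetitions, so
    \<open>col\<close> is injective on a simplex it comes from, and such a simplex is
    colourful.\<close>
  moreover have "set ` A.supp b \<subseteq> (`) col ` colourful_simplices K m V (d + 1)"
  proof
    fix \<tau> assume "\<tau> \<in> set ` A.supp b"
    then obtain ys where ys: "\<tau> = set ys" "b ys \<noteq> \<one>\<^bsub>A\<^esub>" by (auto simp: A.supp_def)
    then obtain xs where xs: "map col xs = ys" "c xs \<noteq> \<one>\<^bsub>A\<^esub>" "distinct ys" using bD by blast
    note x = cD[OF xs(2)]
    have inj: "inj_on col (set xs)" using xs(1,3) by (auto simp: distinct_map)
    have "card (set xs \<inter> V i) \<le> 1" if "i \<le> m" for i
    proof -
      have "v = w" if "v \<in> set xs \<inter> V i" "w \<in> set xs \<inter> V i" for v w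
        using that col_eq[OF \<open>i \<le> m\<close>] inj by (auto dest: inj_onD)
      then show ?thesis by (simp add: card_le_Suc0_iff_eq)
    qed
    then have "set xs \<in> colourful_simplices K m V (d + 1)"
      using x by (simp add: colourful_simplices_def has_dim_def colourful_def distinct_card)
    moreover have "\<tau> = col ` set xs" using ys(1) xs(1) by auto
    ultimately show "\<tau> \<in> (`) col ` colourful_simplices K m V (d + 1)" by blast
  qed
  \<comment> \<open>\<open>vertices M\<close> has \<open>m + 1\<close> elements, which turns the
    bound into \<open>m - d\<close>.\<close>
  ultimately show ?thesis
    using surj_card_le[of "colourful_simplices K m V (d + 1)" "set ` A.supp b" "(`) col"] assms(7)
    by fastforce
qed

end
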